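(* For any integer $k$, every oriented graph $D$ with $\delta^{0}(D)>k/2$ contains every oriented path of length $k$ with two blocks.
   Context: All digraphs are finite, with non-empty vertex set, and have no loops or parallel arcs (no two arcs with the same tail and the same head). An oriented graph is a digraph without directed cycles of length two, i.e. for distinct vertices $u,v$ at most one of $(u,v)$, $(v,u)$ is an arc. The out-degree (resp. in-degree) of a vertex $v$ is the number of vertices $u$ such that $(v,u)$ (resp. $(u,v)$) is an arc. $\delta^{+}(D)$ and $\delta^{-}(D)$ denote the minimum out-degree and minimum in-degree of $D$ over all its vertices, and the minimum semi-degree is $\delta^{0}(D)=\min\{\delta^{+}(D),\delta^{-}(D)\}$. An oriented path is an orientation of an undirected path (each edge is assigned exactly one direction); its length is its number of arcs. A directed path is an oriented path in which any two adjacent arcs have the same orientation. A block of an oriented path $P$ is a maximal directed subpath of $P$. Thus an oriented path of length $k$ with two blocks has, for some integers $s,t\ge 1$ with $s+t=k$, distinct vertices $u_0,u_1,\dots,u_{k}$ and either consists of $s$ forward arcs $(u_{i-1},u_i)$, $1\le i\le s$, followed by $t$ backward arcs $(u_i,u_{i-1})$, $s+1\le i\le k$, or of $s$ backward arcs $(u_i,u_{i-1})$, $1\le i\le s$, followed by $t$ forward arcs $(u_{i-1},u_i)$, $s+1\le i\le k$. A digraph $D$ contains an oriented path $P$ if it has a (not necessarily induced) subdigraph isomorphic to $P$. *)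

theory Defs
  imports Complex_Main "Graph_Theory.Digraph_Component" "Graph_Theory.Digraph_Isomorphism"
begin

locale oriented_graph = digraph +
  assumes verts_nonempty: "verts G \<noteq> {}"
    and no_two_cycle: "u \<rightarrow>\<^bsub>G\<^esub> v \<Longrightarrow> \<not> v \<rightarrow>\<^bsub>G\<^esub> u"

definition min_out_degree :: "('a, 'b) pre_digraph \<Rightarrow> nat" where
  "min_out_degree D = Min (out_degree D ` verts D)"

definition min_in_degree :: "('a, 'b) pre_digraph \<Rightarrow> nat" where
  "min_in_degree D = Min (in_degree D ` verts D)"

definition min_semidegree :: "('a, 'b) pre_digraph \<Rightarrow> nat" where
  "min_semidegree D = min (min_out_degree D) (min_in_degree D)"

text \<open>The list \<open>us\<close> enumerates the vertices of the underlying undirected path in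
  path order; the path with a single vertex and no arc is included.\<close>

definition oriented_path :: "('a, 'b) pre_digraph \<Rightarrow> bool" where
  "oriented_path P \<longleftrightarrow> oriented_graph P \<and>
    (\<exists>us. distinct us \<and> set us = verts P \<and>
      (\<forall>u v. (u \<rightarrow>\<^bsub>P\<^esub> v \<or> v \<rightarrow>\<^bsub>P\<^esub> u) \<longleftrightarrow>
        (\<exists>i. Suc i < length us \<and> {u, v} = {us ! i, us ! Suc i})))"

definition path_length :: "('a, 'b) pre_digraph \<Rightarrow> nat" where
  "path_length P = card (arcs P)"

text \<open>Two distinct arcs of an oriented path share at most one vertex. If they share one,
  they have the same orientation along the path iff that vertex is the head of one of
  them and the tail of the other.\<close>

definition directed_path :: "('a, 'b) pre_digraph \<Rightarrow> bool" where
  "directed_path P \<longleftrightarrow> oriented_path P \<and>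
    (\<forall>e\<in>arcs P. \<forall>f\<in>arcs P.
      e \<noteq> f \<and> {tail P e, head P e} \<inter> {tail P f, head P f} \<noteq> {} \<longrightarrow>
      head P e = tail P f \<or> head P f = tail P e)"

text \<open>A subgraph carries the same tail and head functions as the ambient digraph, so
  distinct blocks differ in their vertices or arcs.\<close>

definition blocks :: "('a, 'b) pre_digraph \<Rightarrow> ('a, 'b) pre_digraph set" where
  "blocks P = {B. pre_digraph.max_subgraph P directed_path B}"

definition contains :: "('a, 'b) pre_digraph \<Rightarrow> ('c, 'd) pre_digraph \<Rightarrow> bool" where
  "contains D P \<longleftrightarrow> (\<exists>H. subgraph H D \<and> digraph_iso P H)"

end

theory Submission
  imports Defs
begin

text \<open>The two branches of a two-block path are directed paths of some lengths \<open>s\<close> and \<open>t\<close> that share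
  only their common last vertex; the other kind of two-block path becomes this one after reversing
  all arcs, which keeps the semidegree. So let \<open>d\<close> be the minimum semidegree, \<open>s + t < 2 * d\<close>, and call
  \<open>confluent E s t\<close> the existence of two such directed paths in the digraph with arc relation \<open>E\<close>.
  Lengthening the longer branch, assume \<open>s + t = 2 * d - 1\<close> and \<open>t < d\<close>, and suppose that the two paths
  do not exist.

  An arc from the last vertex of a directed path with vertices \<open>v\<^sub>0, \<dots>, v\<^sub>m\<close> back to \<open>v\<^sub>j\<close> gives a
  confluent pair of lengths \<open>j\<close> and \<open>m - j\<close> at \<open>v\<^sub>j\<close>. If all out-neighbours of \<open>v\<^sub>m\<close> lie on the path, there
  are at least \<open>d\<close> such \<open>j\<close>, none of them with \<open>s \<le> j \<le> m - t\<close>; counting shows that some out-neighbour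
  is among the first \<open>d - 1\<close> vertices (lemma \<open>stuck_end_returns_early\<close>).

  Now take a longest cycle \<open>C\<close>, of length \<open>c\<close>. A path outside \<open>C\<close> that enters \<open>C\<close> can be continued around \<open>C\<close>
  until it is stuck. The stuck end does not return to the part before \<open>C\<close>, since this would give a longer
  cycle; hence that part has fewer than \<open>d - 1\<close> vertices (\<open>entering_short\<close>). Similarly a longest path
  leaving \<open>C\<close> has to come back to \<open>C\<close>. If \<open>C\<close> has arcs to or from its complement, this
  yields an ear: a path \<open>f\<close> outside \<open>C\<close> with \<open>q \<le> d - 2\<close> vertices whose first vertex has all its
  in-neighbours, and whose last vertex all its out-neighbours, in \<open>f\<close> and \<open>C\<close> (\<open>closed_ear_exists\<close>). If
  \<open>C\<close> has no such arcs, the chords at one vertex already give a contradiction (\<open>some_arc_crosses\<close>).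

  Let \<open>X\<close> and \<open>Y\<close> be the positions on \<open>C\<close>, modulo \<open>c\<close>, of the in-neighbours of the first and the
  out-neighbours of the last vertex of \<open>f\<close>. Each has at least \<open>d - q + 1\<close> elements. For \<open>x \<in> X\<close> and
  \<open>x + g \<in> Y\<close> with \<open>1 \<le> g \<le> c\<close>, the cycle through the ear is not longer than \<open>C\<close>, so \<open>g > q\<close>; and the
  vertex at \<open>x + g\<close> is the end of a confluent pair of lengths \<open>g - 1\<close> and \<open>c - g + q\<close>, which rules out
  \<open>t + 1 \<le> g \<le> c + q - s\<close>. A set of residues whose differences to another set avoid two intervals is
  small (\<open>two_intervals\<close>): here \<open>card X + card Y \<le> 2 * d - 2 * q + 1\<close>, a contradiction. This
  needs \<open>s < c\<close>; for \<open>c \<le> s\<close>, arcs from the last vertex of \<open>f\<close> back into \<open>f\<close> give confluent pairs as well,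
  so there are few of them, \<open>Y\<close> is larger, and avoiding the first interval alone is impossible.

  It remains to see that an oriented path with exactly two blocks changes its orientation exactly once.
  A directed subpath is connected, so it contains every arc of the path between two of its arcs and
  cannot reach across a change of orientation. Hence without a change there is one block, and two
  changes leave three arcs in three different blocks.\<close>

section \<open>Sets of residues that avoid intervals of differences\<close>

text \<open>Subsets of the integers modulo \<open>c\<close> are represented by their preimages in the integers, so that
  translations need no reduction modulo \<open>c\<close>. The size of the residue set is the number of elements in
  any \<open>c\<close> consecutive integers.\<close>

definition periodic :: "int \<Rightarrow> int set \<Rightarrow> bool" where
  "periodic c X \<longleftrightarrow> (\<forall>x. x + c \<in> X \<longleftrightarrow> x \<in> X)"

lemma periodic_add: "periodic c X \<Longrightarrow> x + c \<in> X \<longleftrightarrow> x \<in> X"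
  by (simp add: periodic_def)

lemma periodic_diff: "periodic c X \<Longrightarrow> x - c \<in> X \<longleftrightarrow> x \<in> X"
  using periodic_add[of c X "x - c"] by simp

lemma periodic_mult:
  assumes "periodic c X"
  shows "x + k * c \<in> X \<longleftrightarrow> x \<in> X"
proof (induction k rule: int_induct[where k=0])
  case (step1 i)
  then show ?case using periodic_add[OF assms, of "x + i * c"] by (simp add: algebra_simps)
next
  case (step2 i)
  then show ?case using periodic_diff[OF assms, of "x + i * c"] by (simp add: algebra_simps)
qed simp

lemma periodic_translate: "periodic c X \<Longrightarrow> periodic c {x. x + a \<in> X}"
  using periodic_add[of c X] by (simp add: periodic_def) (metis add.commute add.left_commute)

lemma card_period:
  assumes "periodic c X" "0 < c"
  shows "card (X \<inter> {a<..a + c}) = card (X \<inter> {0<..c})"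
proof -
  have step: "card (X \<inter> {a + 1<..a + 1 + c}) = card (X \<inter> {a<..a + c})" for a
  proof -
    let ?S = "X \<inter> {a + 1<..a + c}"
    have "{a<..a + c} = insert (a + 1) {a + 1<..a + c}"
      and "{a + 1<..a + 1 + c} = insert (a + 1 + c) {a + 1<..a + c}"
      using \<open>0 < c\<close> by auto
    then have 1: "X \<inter> {a<..a + c} = (if a + 1 \<in> X then insert (a + 1) ?S else ?S)"
      and 2: "X \<inter> {a + 1<..a + 1 + c} = (if a + 1 \<in> X then insert (a + 1 + c) ?S else ?S)"
      using periodic_add[OF assms(1), of "a + 1"] by auto
    show ?thesis unfolding 1 2 by simp
  qed
  show ?thesis
  proof (induction a rule: int_induct[where k=0])
    case (step1 i)
    then show ?case using step[of i] by simp
  next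
    case (step2 i)
    then show ?case using step[of "i - 1"] by simp
  qed simp
qed

lemma card_period_translate:
  assumes "periodic c X" "0 < c"
  shows "card ({x. x + a \<in> X} \<inter> {0<..c}) = card (X \<inter> {0<..c})"
proof -
  have "X \<inter> {a<..a + c} = (\<lambda>x. x + a) ` ({x. x + a \<in> X} \<inter> {0<..c})"
  proof (intro equalityI subsetI)
    fix z assume "z \<in> X \<inter> {a<..a + c}"
    then show "z \<in> (\<lambda>x. x + a) ` ({x. x + a \<in> X} \<inter> {0<..c})"
      by (intro image_eqI[of _ _ "z - a"]) auto
  qed auto
  then have "card (X \<inter> {a<..a + c}) = card ({x. x + a \<in> X} \<inter> {0<..c})"
    by (simp add: card_image)
  then show ?thesis using card_period[OF assms] by simp
qed

text \<open>The setting is that of two sets of residues \<open>X\<close>, \<open>Y\<close> with no element of \<open>Y\<close> at distance \<open>1, \<dots>, q\<close> after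
  an element of \<open>X\<close>, translated so that \<open>0\<close> is the last element of \<open>X\<close> before some element \<open>y0\<close> of \<open>Y\<close>.
  All of \<open>X + 1\<close> is forbidden for \<open>Y\<close>, and so are the \<open>q - 1\<close> further residues that follow it after the
  gap of \<open>X\<close> behind \<open>0\<close>. The second bound is for the case that \<open>X\<close> has another such gap, namely
  behind its last element before \<open>y\<close>.\<close>

lemma one_interval_normalised:
  fixes c q :: int
  assumes X: "periodic c X" and Y: "periodic c Y" and "0 < c" "1 \<le> q"
    and "0 \<in> X" and y0: "y0 \<in> Y" "1 \<le> y0" "y0 \<le> c" and gap: "X \<inter> {1..<y0} = {}"
    and near: "\<And>x g. x \<in> X \<Longrightarrow> 1 \<le> g \<Longrightarrow> g \<le> q \<Longrightarrow> x + g \<notin> Y"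
  shows "int (card (X \<inter> {0<..c})) + int (card (Y \<inter> {0<..c})) \<le> c - q + 1"
    and "\<lbrakk>x \<in> X; y \<in> Y; 0 < x; x < y; y \<le> c\<rbrakk> \<Longrightarrow>
      int (card (X \<inter> {0<..c})) + int (card (Y \<inter> {0<..c})) \<le> c - 2 * q + 2"
proof -
  have "q < y0"
    using near[OF \<open>0 \<in> X\<close>, of y0] y0 by force
  have "c \<in> X" using periodic_add[OF X, of 0] \<open>0 \<in> X\<close> by simp
  \<comment> \<open>\<open>S\<close> together with \<open>1\<close>, the successor of \<open>0\<close>, is \<open>X + 1\<close> within one period.\<close>
  define S where "S = (\<lambda>x. x + 1) ` (X \<inter> {0<..<c})"
  have "X \<inter> {0<..c} = insert c (X \<inter> {0<..<c})" using \<open>c \<in> X\<close> \<open>0 < c\<close> by auto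
  then have cX: "int (card (X \<inter> {0<..c})) = int (card S) + 1"
    unfolding S_def by (simp add: card_image)
  have S0: "S \<inter> {1..q} = {}" unfolding S_def using gap \<open>q < y0\<close> by auto
  have SY: "S \<inter> Y = {}" unfolding S_def using near[of _ 1] \<open>1 \<le> q\<close> by auto
  have qY: "{1..q} \<inter> Y = {}" using near[OF \<open>0 \<in> X\<close>] by auto
  have finS: "finite S" and subS: "S \<subseteq> {0<..c}" unfolding S_def by auto
  have free: "int (card W) + int (card (Y \<inter> {0<..c})) \<le> c" if "W \<subseteq> {0<..c}" "W \<inter> Y = {}" for W
  proof -
    have "finite W" using that(1) by (rule finite_subset) simp
    then have "card W + card (Y \<inter> {0<..c}) = card (W \<union> (Y \<inter> {0<..c}))"
      using that by (subst card_Un_disjoint) auto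
    also have "\<dots> \<le> card {0<..c}" using that by (intro card_mono) auto
    finally show ?thesis using \<open>0 < c\<close> by simp
  qed
  have "card ({1..q} \<union> S) = card {1..q} + card S"
    using S0 finS by (subst card_Un_disjoint) auto
  moreover have "int (card ({1..q} \<union> S)) + int (card (Y \<inter> {0<..c})) \<le> c"
    using \<open>q < y0\<close> y0 subS SY qY by (intro free) auto
  ultimately show "int (card (X \<inter> {0<..c})) + int (card (Y \<inter> {0<..c})) \<le> c - q + 1"
    using cX \<open>1 \<le> q\<close> by simp
  show "int (card (X \<inter> {0<..c})) + int (card (Y \<inter> {0<..c})) \<le> c - 2 * q + 2"
    if "x \<in> X" "y \<in> Y" "0 < x" "x < y" "y \<le> c" for x y
  proof -
    define z where "z = Max (X \<inter> {0<..<y})"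
    have "z \<in> X \<inter> {0<..<y}" unfolding z_def using that by (intro Max_in) auto
    then have z: "z \<in> X" "0 < z" "z < y" by auto
    have zmax: "w \<le> z" if "w \<in> X" "w < y" for w
      using that z unfolding z_def by (cases "0 < w") auto
    have "z + q < y" using near[OF z(1), of "y - z"] z that by force
    have "y0 \<le> z" using gap z by force
    let ?W = "{1..q} \<union> S \<union> {z + 2..z + q}"
    have "({1..q} \<union> S) \<inter> {z + 2..z + q} = {}"
    proof -
      have False if "w \<in> X" "w + 1 \<in> {z + 2..z + q}" for w
        using zmax[OF that(1)] that \<open>z + q < y\<close> by auto
      then show ?thesis using \<open>q < y0\<close> \<open>y0 \<le> z\<close> unfolding S_def by fastforce
    qed
    then have "card ?W = card {1..q} + card S + card {z + 2..z + q}"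
      using S0 finS by (subst card_Un_disjoint, auto)+
    moreover have "int (card ?W) + int (card (Y \<inter> {0<..c})) \<le> c"
    proof (rule free)
      show "?W \<subseteq> {0<..c}" using subS \<open>q < y0\<close> y0 z that \<open>z + q < y\<close> by auto
      have "{z + 2..z + q} \<inter> Y = {}"
        using near[OF z(1), of "w - z" for w] by force
      then show "?W \<inter> Y = {}" using SY qY by auto
    qed
    ultimately show ?thesis using cX \<open>1 \<le> q\<close> by simp
  qed
qed

text \<open>A second forbidden interval of differences, \<open>t + 1, \<dots>, t + l\<close>, costs \<open>l - 1\<close> more residues. If some
  element of \<open>X\<close> in the period precedes one of \<open>Y\<close>, then \<open>X\<close> has two gaps of length at least \<open>q\<close>, and
  the first interval alone gives enough because \<open>l \<le> q\<close>. Otherwise \<open>Y\<close> comes entirely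
  before \<open>X\<close> within the period. If \<open>X\<close> has at least \<open>l - 1\<close> holes between its first element \<open>x1\<close> and
  \<open>c\<close>, it is small enough; if it has fewer, then every window of \<open>l\<close> residues that meets the range from
  \<open>x1\<close> to \<open>c\<close> contains an element of \<open>X\<close>, and the second interval excludes a full range for \<open>Y\<close>.\<close>

lemma two_intervals_normalised:
  fixes c q t l :: int
  assumes X: "periodic c X" and Y: "periodic c Y" and "0 < c" "1 \<le> l" "l \<le> q" "q \<le> t" "t + l \<le> c"
    and "0 \<in> X" and y0: "y0 \<in> Y" "1 \<le> y0" "y0 \<le> c" and gap: "X \<inter> {1..<y0} = {}"
    and near: "\<And>x g. x \<in> X \<Longrightarrow> 1 \<le> g \<Longrightarrow> g \<le> q \<Longrightarrow> x + g \<notin> Y"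
    and far: "\<And>x g. x \<in> X \<Longrightarrow> t + 1 \<le> g \<Longrightarrow> g \<le> t + l \<Longrightarrow> x + g \<notin> Y"
  shows "int (card (X \<inter> {0<..c})) + int (card (Y \<inter> {0<..c})) \<le> c - q - l + 2"
proof (cases "\<exists>x\<in>X. \<exists>y\<in>Y. 0 < x \<and> x < y \<and> y \<le> c")
  case True
  then obtain x y where "x \<in> X" "y \<in> Y" "0 < x" "x < y" "y \<le> c" by blast
  from one_interval_normalised(2)[OF X Y \<open>0 < c\<close> _ \<open>0 \<in> X\<close> y0 gap _ this, of q] near \<open>1 \<le> l\<close> \<open>l \<le> q\<close>
  show ?thesis by simp
next
  case False
  have "c \<in> X" using periodic_add[OF X, of 0] \<open>0 \<in> X\<close> by simp
  let ?X = "X \<inter> {0<..c}" and ?Y = "Y \<inter> {0<..c}"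
  define x1 where "x1 = Min ?X"
  have "x1 \<in> ?X" unfolding x1_def using \<open>c \<in> X\<close> \<open>0 < c\<close> by (intro Min_in) auto
  have x1: "x1 \<le> x" if "x \<in> ?X" for x
    unfolding x1_def using that by (intro Min_le) auto
  have subX: "?X \<subseteq> {x1..c}" using x1 by auto
  have subY: "?Y \<subseteq> {q + 1..x1}"
  proof
    fix y assume "y \<in> ?Y"
    then show "y \<in> {q + 1..x1}"
      using near[OF \<open>0 \<in> X\<close>, of y] False \<open>x1 \<in> ?X\<close> by force
  qed
  have cX: "int (card ?X) \<le> c - x1 + 1"
    using card_mono[OF _ subX] \<open>x1 \<in> ?X\<close> by (simp add: le_nat_iff)
  have cY: "int (card ?Y) \<le> max 0 (x1 - q)"
    using card_mono[OF _ subY] by simp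
  have "q + 1 \<le> x1" using subY y0 by auto
  show ?thesis
  proof (cases "int (card ?X) \<le> c - x1 + 2 - l")
    case True
    then show ?thesis using cY \<open>q + 1 \<le> x1\<close> by simp
  next
    case dense: False
    have "?Y \<subseteq> {q + 1..x1 - c + t} \<union> {t + l + 1..x1}"
    proof
      fix y assume y: "y \<in> ?Y"
      \<comment> \<open>The elements of \<open>?W\<close>, lowered by \<open>c\<close>, are those at a distance \<open>t + 1, \<dots>, t + l\<close> before \<open>y\<close>.\<close>
      let ?W = "{y + c - t - l..y + c - t - 1}"
      have W: "x \<notin> ?W" if "x \<in> X" for x
        using far[of "x - c" "y + c - x"] that periodic_diff[OF X, of x] y by auto
      have "y \<le> x1 - c + t \<or> t + l < y"
      proof (rule ccontr)
        assume "\<not> (y \<le> x1 - c + t \<or> t + l < y)"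
        then have "?W \<subseteq> {x1..c}" using W[OF \<open>c \<in> X\<close>] W[of x1] \<open>x1 \<in> ?X\<close> by auto
        then have "?X \<union> ?W \<subseteq> {x1..c}" using subX by blast
        then have "card (?X \<union> ?W) \<le> card {x1..c}" by (rule card_mono[rotated]) simp
        moreover have "?X \<inter> ?W = {}" using W by auto
        then have "card (?X \<union> ?W) = card ?X + card ?W" by (intro card_Un_disjoint) auto
        ultimately have "card ?X + card ?W \<le> card {x1..c}" by simp
        then show False using dense \<open>1 \<le> l\<close> \<open>x1 \<in> ?X\<close> by simp
      qed
      then show "y \<in> {q + 1..x1 - c + t} \<union> {t + l + 1..x1}" using subY y by auto
    qed
    moreover from this have "q + 1 \<le> x1 - c + t \<or> t + l + 1 \<le> x1" using y0 by fastforce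
    ultimately have union: "card ?Y \<le> card ({q + 1..x1 - c + t} \<union> {t + l + 1..x1})"
      and gaps: "q + 1 \<le> x1 - c + t \<or> t + l + 1 \<le> x1"
      by (auto intro!: card_mono)
    from order_trans[OF union card_Un_le] have "int (card ?Y) \<le> max 0 (x1 - c + t - q) + max 0 (x1 - t - l)" by simp
    with gaps show ?thesis using cX \<open>q + 1 \<le> x1\<close> assms(4-7) \<open>x1 \<in> ?X\<close> by (auto simp: max_def split: if_splits)
  qed
qed

lemma nearest_preceding:
  assumes X: "periodic c X" and "0 < c" "x0 \<in> X"
  obtains x where "x \<in> X" "1 \<le> y - x" "y - x \<le> c" "X \<inter> {x + 1..<y} = {}"
proof -
  define z where "z = y - c + (x0 - y) mod c"
  have "(x0 - y) mod c = x0 - y - c * ((x0 - y) div c)"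
    by (simp add: minus_mult_div_eq_mod)
  then have "z = x0 + (- ((x0 - y) div c) - 1) * c"
    unfolding z_def by (simp add: algebra_simps)
  then have "z \<in> X" using periodic_mult[OF X] \<open>x0 \<in> X\<close> by metis
  moreover have "y - c \<le> z" "z < y" unfolding z_def using \<open>0 < c\<close> pos_mod_bound[of c "x0 - y"] by auto
  ultimately have ne: "X \<inter> {y - c..<y} \<noteq> {}" by auto
  define x where "x = Max (X \<inter> {y - c..<y})"
  have "x \<in> X \<inter> {y - c..<y}" unfolding x_def using ne by (intro Max_in) auto
  moreover have "w \<le> x" if "w \<in> X \<inter> {y - c..<y}" for w
    unfolding x_def using that by (intro Max_ge) auto
  ultimately show ?thesis by (intro that[of x]) force+
qed

lemma one_interval:
  fixes c q :: int
  assumes X: "periodic c X" and Y: "periodic c Y" and "0 < c" "1 \<le> q" "X \<noteq> {}" "Y \<noteq> {}"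
    and near: "\<And>x g. x \<in> X \<Longrightarrow> 1 \<le> g \<Longrightarrow> g \<le> q \<Longrightarrow> x + g \<notin> Y"
  shows "int (card (X \<inter> {0<..c})) + int (card (Y \<inter> {0<..c})) \<le> c - q + 1"
proof -
  obtain x0 y0 where "x0 \<in> X" "y0 \<in> Y" using assms by blast
  obtain x where x: "x \<in> X" "1 \<le> y0 - x" "y0 - x \<le> c" "X \<inter> {x + 1..<y0} = {}"
    using nearest_preceding[OF X \<open>0 < c\<close> \<open>x0 \<in> X\<close>] by blast
  have "int (card ({z. z + x \<in> X} \<inter> {0<..c})) + int (card ({z. z + x \<in> Y} \<inter> {0<..c})) \<le> c - q + 1"
  proof (rule one_interval_normalised(1)[of c _ _ q "y0 - x"])
    show "w + g \<notin> {z. z + x \<in> Y}" if "w \<in> {z. z + x \<in> X}" "1 \<le> g" "g \<le> q" for w g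
      using near[of "w + x" g] that by (simp add: algebra_simps)
    show "{z. z + x \<in> X} \<inter> {1..<y0 - x} = {}" using x(4) by (auto simp: disjoint_iff)
  qed (use x \<open>y0 \<in> Y\<close> assms periodic_translate in auto)
  then show ?thesis
    by (simp add: card_period_translate[OF X \<open>0 < c\<close>] card_period_translate[OF Y \<open>0 < c\<close>])
qed

lemma two_intervals_ordered:
  fixes c q t l :: int
  assumes X: "periodic c X" and Y: "periodic c Y" and "0 < c" "1 \<le> l" "l \<le> q" "q \<le> t" "t + l \<le> c"
    and "X \<noteq> {}" "Y \<noteq> {}"
    and near: "\<And>x g. x \<in> X \<Longrightarrow> 1 \<le> g \<Longrightarrow> g \<le> q \<Longrightarrow> x + g \<notin> Y"
    and far: "\<And>x g. x \<in> X \<Longrightarrow> t + 1 \<le> g \<Longrightarrow> g \<le> t + l \<Longrightarrow> x + g \<notin> Y"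
  shows "int (card (X \<inter> {0<..c})) + int (card (Y \<inter> {0<..c})) \<le> c - q - l + 2"
proof -
  obtain x0 y0 where "x0 \<in> X" "y0 \<in> Y" using assms by blast
  obtain x where x: "x \<in> X" "1 \<le> y0 - x" "y0 - x \<le> c" "X \<inter> {x + 1..<y0} = {}"
    using nearest_preceding[OF X \<open>0 < c\<close> \<open>x0 \<in> X\<close>] by blast
  have "int (card ({z. z + x \<in> X} \<inter> {0<..c})) + int (card ({z. z + x \<in> Y} \<inter> {0<..c})) \<le> c - q - l + 2"
  proof (rule two_intervals_normalised[of c _ _ l q t "y0 - x"])
    show "w + g \<notin> {z. z + x \<in> Y}" if "w \<in> {z. z + x \<in> X}" "1 \<le> g" "g \<le> q" for w g
      using near[of "w + x" g] that by (simp add: algebra_simps)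
    show "w + g \<notin> {z. z + x \<in> Y}" if "w \<in> {z. z + x \<in> X}" "t + 1 \<le> g" "g \<le> t + l" for w g
      using far[of "w + x" g] that by (simp add: algebra_simps)
    show "{z. z + x \<in> X} \<inter> {1..<y0 - x} = {}" using x(4) by (auto simp: disjoint_iff)
  qed (use x \<open>y0 \<in> Y\<close> assms periodic_translate in auto)
  then show ?thesis
    by (simp add: card_period_translate[OF X \<open>0 < c\<close>] card_period_translate[OF Y \<open>0 < c\<close>])
qed

text \<open>The ordering \<open>l \<le> q\<close> is no restriction: translating \<open>Y\<close> by \<open>t\<close> turns the second interval into an
  initial one, and the first, which modulo \<open>c\<close> becomes \<open>c - t + 1, \<dots>, c - t + q\<close>, into the later one.\<close>

lemma two_intervals:
  fixes c q t l :: int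
  assumes X: "periodic c X" and Y: "periodic c Y" and "0 < c" "1 \<le> l" "1 \<le> q" "q \<le> t" "t + l \<le> c"
    and ne: "X \<noteq> {}" "Y \<noteq> {}"
    and near: "\<And>x g. x \<in> X \<Longrightarrow> 1 \<le> g \<Longrightarrow> g \<le> q \<Longrightarrow> x + g \<notin> Y"
    and far: "\<And>x g. x \<in> X \<Longrightarrow> t + 1 \<le> g \<Longrightarrow> g \<le> t + l \<Longrightarrow> x + g \<notin> Y"
  shows "int (card (X \<inter> {0<..c})) + int (card (Y \<inter> {0<..c})) \<le> c - q - l + 2"
proof (cases "l \<le> q")
  case True
  then show ?thesis using assms by (intro two_intervals_ordered[of c X Y l q t]) auto
next
  case False
  let ?Y = "{y. y + t \<in> Y}"
  obtain y0 where "y0 \<in> Y" using ne by blast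
  have "int (card (X \<inter> {0<..c})) + int (card (?Y \<inter> {0<..c})) \<le> c - l - q + 2"
  proof (rule two_intervals_ordered[of c _ _ q l "c - t"])
    show "?Y \<noteq> {}" using \<open>y0 \<in> Y\<close> by (auto intro!: exI[of _ "y0 - t"])
    show "x + g \<notin> ?Y" if "x \<in> X" "1 \<le> g" "g \<le> l" for x g
      using far[of x "g + t"] that by (simp add: algebra_simps)
    show "x + g \<notin> ?Y" if "x \<in> X" "c - t + 1 \<le> g" "g \<le> c - t + q" for x g
      using near[of x "g + t - c"] that periodic_diff[OF Y, of "x + g + t"] by (simp add: algebra_simps)
  qed (use assms False periodic_translate in auto)
  then show ?thesis by (simp add: card_period_translate[OF Y \<open>0 < c\<close>])
qed

section \<open>Directed paths and cycles under a semidegree condition\<close>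

text \<open>Lower bounds on the lengths suffice, since the paths can be shortened at their start.\<close>

definition confluent :: "('a \<Rightarrow> 'a \<Rightarrow> bool) \<Rightarrow> nat \<Rightarrow> nat \<Rightarrow> bool" where
  "confluent E s t \<longleftrightarrow> (\<exists>xs ys w. successively E (xs @ [w]) \<and> successively E (ys @ [w]) \<and>
     distinct (xs @ ys @ [w]) \<and> s \<le> length xs \<and> t \<le> length ys)"

lemma confluentI:
  assumes "successively E (xs @ [w])" "successively E (ys @ [w])" "distinct (xs @ ys @ [w])"
    "s \<le> length xs" "t \<le> length ys"
  shows "confluent E s t"
  using assms unfolding confluent_def by blast

lemma confluent_mono: "confluent E s t \<Longrightarrow> s' \<le> s \<Longrightarrow> t' \<le> t \<Longrightarrow> confluent E s' t'"
  unfolding confluent_def by (meson le_trans)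

lemma confluent_commute:
  assumes "confluent E s t"
  shows "confluent E t s"
proof -
  obtain xs ys w where "successively E (xs @ [w])" "successively E (ys @ [w])"
    "distinct (xs @ ys @ [w])" "s \<le> length xs" "t \<le> length ys"
    using assms unfolding confluent_def by blast
  then show ?thesis by (intro confluentI[of E ys w xs]) auto
qed

locale semidegree_digraph =
  fixes V :: "'a set" and E :: "'a \<Rightarrow> 'a \<Rightarrow> bool" and d :: nat
  assumes finite_V: "finite V"
    and nonempty: "V \<noteq> {}"
    and arc_in_V: "E u v \<Longrightarrow> u \<in> V \<and> v \<in> V"
    and asym: "E u v \<Longrightarrow> \<not> E v u"
    and out_degree: "v \<in> V \<Longrightarrow> d \<le> card {u. E v u}"
    and in_degree: "v \<in> V \<Longrightarrow> d \<le> card {u. E u v}"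
begin

definition path :: "'a list \<Rightarrow> bool" where
  "path xs \<longleftrightarrow> successively E xs \<and> distinct xs \<and> set xs \<subseteq> V"

definition cycle :: "'a list \<Rightarrow> bool" where
  "cycle xs \<longleftrightarrow> path xs \<and> xs \<noteq> [] \<and> E (last xs) (hd xs)"

lemma path_length_le: "path xs \<Longrightarrow> length xs \<le> card V"
  unfolding path_def using card_mono[OF finite_V, of "set xs"] by (simp add: distinct_card)

lemma longest_exists:
  assumes "Q xs" "\<And>xs. Q xs \<Longrightarrow> path (f xs)"
  obtains ys where "Q ys" "\<And>xs. Q xs \<Longrightarrow> length (f xs) \<le> length (f ys)"
proof -
  have "\<forall>ys. Q ys \<longrightarrow> length (f ys) \<le> card V" using assms(2) path_length_le by simp
  then obtain ys where "Q ys" "\<forall>xs. Q xs \<longrightarrow> length (f xs) \<le> length (f ys)"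
    using ex_has_greatest_nat[of Q xs "\<lambda>xs. length (f xs)" "Suc (card V)"] assms(1) by (auto simp: less_Suc_eq_le)
  then show ?thesis using that by blast
qed

lemma finite_out: "finite {u. E v u}" and finite_in: "finite {u. E u v}"
  by (rule finite_subset[OF _ finite_V], use arc_in_V in blast)+

lemma path_append:
  "path (xs @ ys) \<longleftrightarrow> path xs \<and> path ys \<and> set xs \<inter> set ys = {} \<and>
     (xs = [] \<or> ys = [] \<or> E (last xs) (hd ys))"
  unfolding path_def by (simp add: successively_append_iff) blast

lemma path_drop: "path xs \<Longrightarrow> path (drop n xs)"
  using path_append[of "take n xs" "drop n xs"] by simp

lemma cycle_drop:
  assumes "path xs" "j < length xs" "E (last xs) (xs ! j)"
  shows "cycle (drop j xs)"
  using assms path_drop[OF assms(1)] by (simp add: cycle_def last_drop hd_drop_conv_nth)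

lemma confluent_back_arc:
  assumes "path xs" "j < length xs" "E (last xs) (xs ! j)"
  shows "confluent E j (length xs - 1 - j)"
proof -
  let ?a = "take j xs" and ?w = "xs ! j" and ?b = "drop (Suc j) xs"
  have "path ((?a @ [?w]) @ ?b)"
    using assms(1) by (simp add: id_take_nth_drop[OF assms(2), symmetric])
  then have p: "path (?a @ [?w])" "path ?b" "(set ?a \<union> {?w}) \<inter> set ?b = {}"
    unfolding path_append[of "?a @ [?w]"] by auto
  have "last ?b = last xs" if "?b \<noteq> []" using that by (simp add: last_drop)
  then show ?thesis
    using p assms by (intro confluentI[of _ ?a ?w ?b]) (auto simp: path_def successively_append_iff)
qed

lemma maximal_path_end:
  assumes "path (xs @ zs)" "xs \<noteq> []"
    and "\<And>zs'. path (xs @ zs') \<Longrightarrow> length zs' \<le> length zs"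
    and "E (last (xs @ zs)) u"
  shows "u \<in> set (xs @ zs)"
proof (rule ccontr)
  assume "u \<notin> set (xs @ zs)"
  then have "path ((xs @ zs) @ [u])"
    unfolding path_append[of "xs @ zs"] using assms arc_in_V by (auto simp: path_def)
  with assms(3)[of "zs @ [u]"] show False by simp
qed

text \<open>A path that cannot be extended has all out-neighbours of its last vertex behind it.\<close>

lemma cycle_exists:
  assumes "0 < d"
  shows "\<exists>xs. cycle xs \<and> d < length xs"
proof -
  obtain v where "v \<in> V" using nonempty by blast
  then have "path ([v] @ [])" by (simp add: path_def)
  then obtain zs where zs: "path ([v] @ zs)" "\<And>zs'. path ([v] @ zs') \<Longrightarrow> length zs' \<le> length zs"
    using longest_exists[of "\<lambda>zs. path ([v] @ zs)" "[]" "\<lambda>zs. [v] @ zs"] by auto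
  define R where "R = [v] @ zs"
  have R: "path R" "R \<noteq> []" "\<And>u. E (last R) u \<Longrightarrow> u \<in> set R"
    unfolding R_def using maximal_path_end[OF zs(1) _ zs(2)] zs(1) by auto
  have "last R \<in> V" using R by (auto simp: path_def)
  then have deg: "d \<le> card {u. E (last R) u}" by (rule out_degree)
  then obtain u where "E (last R) u" using \<open>0 < d\<close> by (cases "{u. E (last R) u} = {}") auto
  then obtain k where k: "k < length R" "E (last R) (R ! k)" using R(3) by (metis in_set_conv_nth)
  \<comment> \<open>The earliest out-neighbour of the end closes a cycle through all the others.\<close>
  define j where "j = (LEAST j. E (last R) (R ! j))"
  have j: "E (last R) (R ! j)" "j \<le> k"
    unfolding j_def using k(2) by (auto intro: LeastI Least_le)
  have "{u. E (last R) u} \<subseteq> set (drop j R) - {last R}"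
  proof
    fix u assume u: "u \<in> {u. E (last R) u}"
    then obtain i where i: "i < length R" "u = R ! i" using R(3) by (metis in_set_conv_nth mem_Collect_eq)
    then have "j \<le> i" unfolding j_def using u by (auto intro: Least_le)
    then have "u \<in> set (drop j R)"
      using i by (auto simp: in_set_conv_nth intro!: exI[of _ "i - j"])
    then show "u \<in> set (drop j R) - {last R}" using u asym by auto
  qed
  then have "card {u. E (last R) u} \<le> card (set (drop j R) - {last R})" by (intro card_mono) auto
  also have "\<dots> < card (set (drop j R))"
  proof (rule card_Diff1_less)
    show "last R \<in> set (drop j R)" using last_in_set[of "drop j R"] j k by (simp add: last_drop)
  qed simp
  also have "\<dots> \<le> length (drop j R)" by (rule card_length)
  finally have "d < length (drop j R)" using deg by simp
  moreover have "cycle (drop j R)" using cycle_drop[OF R(1)] j k by simp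
  ultimately show ?thesis by blast
qed

end

section \<open>A longest cycle and its ears\<close>

text \<open>The situation to be refuted, with the lengths normalised so that \<open>t < d\<close> is the shorter one and
  \<open>s + t\<close> is as large as possible.\<close>

locale no_confluent_paths = semidegree_digraph +
  fixes s t :: nat
  assumes t_pos: "1 \<le> t" and t_less: "t < d" and sum_st: "s + t + 1 = 2 * d"
    and no_confluent: "\<not> confluent E s t"
begin

lemma not_confluent:
  assumes "confluent E a b"
  shows "\<not> (s \<le> a \<and> t \<le> b)" "\<not> (t \<le> a \<and> s \<le> b)"
  using assms no_confluent confluent_mono[of E a b s t] confluent_mono[of E b a s t]
    confluent_commute[of E a b] by auto

lemma card_out_positions:
  assumes "distinct xs" "{u. E v u} \<subseteq> set xs"
  shows "card {j. j < length xs \<and> E v (xs ! j)} = card {u. E v u}"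
proof -
  have "bij_betw ((!) xs) {j. j < length xs \<and> E v (xs ! j)} {u. E v u}"
    using assms by (auto simp: bij_betw_def inj_on_def nth_eq_iff_index_eq in_set_conv_nth subset_iff image_iff)
  then show ?thesis by (rule bij_betw_same_card)
qed

text \<open>If all out-neighbours of the last vertex are on the path, each of their at least \<open>d\<close> positions \<open>j\<close>
  yields a confluent pair with lengths \<open>j\<close> and \<open>m - j\<close>, where \<open>m\<close> is the length of the path. So
  \<open>j < s\<close> or \<open>j > m - t\<close>. With all positions at least \<open>j0 \<ge> d - 1\<close> this leaves at most
  \<open>s - j0 + t - 1 < d\<close> of them.\<close>

lemma stuck_end_returns_early:
  assumes "path xs" "xs \<noteq> []" and ret: "\<And>u. E (last xs) u \<Longrightarrow> u \<in> set (drop j0 xs)"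
  shows "j0 + 1 < d"
proof (rule ccontr)
  assume "\<not> j0 + 1 < d"
  let ?m = "length xs - 1"
  define J where "J = {j. j < length xs \<and> E (last xs) (xs ! j)}"
  have dist: "distinct xs" using assms(1) by (simp add: path_def)
  have "last xs \<in> V" using assms(1,2) by (auto simp: path_def)
  then have "d \<le> card {u. E (last xs) u}" by (rule out_degree)
  moreover have "card J = card {u. E (last xs) u}"
    unfolding J_def using ret dist by (intro card_out_positions) (auto dest: in_set_dropD)
  ultimately have "d \<le> card J" by simp
  have "J \<subseteq> {j0..<s} \<union> {?m - t + 1..<?m}"
  proof
    fix j assume "j \<in> J"
    then have j: "j < length xs" "E (last xs) (xs ! j)" by (auto simp: J_def)
    have "j \<noteq> ?m" using j asym[OF j(2)] assms(2) by (auto simp: last_conv_nth)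
    moreover have "j0 \<le> j"
    proof -
      obtain i where "i < length (drop j0 xs)" "drop j0 xs ! i = xs ! j"
        using ret[OF j(2)] by (metis in_set_conv_nth)
      then have "xs ! (j0 + i) = xs ! j" "j0 + i < length xs" by auto
      then show ?thesis using dist j(1) by (auto simp: nth_eq_iff_index_eq)
    qed
    moreover have "\<not> (s \<le> j \<and> t \<le> ?m - j)"
      using not_confluent(1)[OF confluent_back_arc[OF assms(1) j]] by simp
    moreover have "0 < s" using sum_st t_less by simp
    ultimately show "j \<in> {j0..<s} \<union> {?m - t + 1..<?m}" using j by auto
  qed
  then have "card J \<le> card ({j0..<s} \<union> {?m - t + 1..<?m})" by (intro card_mono) auto
  also have "\<dots> \<le> (s - j0) + (t - 1)" by (rule order_trans[OF card_Un_le]) auto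
  also have "\<dots> < d" using \<open>\<not> j0 + 1 < d\<close> sum_st t_pos t_less by simp
  finally show False using \<open>d \<le> card J\<close> by simp
qed

lemma obtains_maximal_extension:
  assumes "path xs" "xs \<noteq> []"
  obtains zs where "path (xs @ zs)" "\<And>u. E (last (xs @ zs)) u \<Longrightarrow> u \<in> set (xs @ zs)"
proof -
  obtain zs where zs: "path (xs @ zs)" "\<And>zs'. path (xs @ zs') \<Longrightarrow> length zs' \<le> length zs"
    using longest_exists[of "\<lambda>zs. path (xs @ zs)" "[]" "\<lambda>zs. xs @ zs"] assms(1) by auto
  then show ?thesis using that maximal_path_end[OF zs(1) assms(2) zs(2)] by blast
qed

end

text \<open>The cycle is parametrised by the integers with period \<open>c\<close>, which turns rotations and arcs of the cycle
  into integer intervals.\<close>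

locale longest_cycle = no_confluent_paths +
  fixes \<gamma> :: "int \<Rightarrow> 'a" and c :: nat
  assumes period: "\<gamma> (i + int c) = \<gamma> i"
    and step: "E (\<gamma> i) (\<gamma> (i + 1))"
    and inj: "inj_on \<gamma> {a<..a + int c}"
    and longest: "cycle xs \<Longrightarrow> length xs \<le> c"
    and long: "d < c"
begin

abbreviation "C \<equiv> range \<gamma>"
abbreviation "seg a b \<equiv> map \<gamma> [a..b]"

lemma c_pos: "0 < c" using long by simp

lemma C_V: "C \<subseteq> V" using step arc_in_V by blast

lemma inj_le: "b - a < int c \<Longrightarrow> inj_on \<gamma> {a..b}"
  by (rule inj_on_subset[OF inj[of "a - 1"]]) auto

lemma periodic_vimage: "periodic (int c) (\<gamma> -` S)"
  by (simp add: periodic_def period)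

lemma C_window: "\<gamma> ` {a<..a + int c} = C"
proof -
  have "\<gamma> i \<in> \<gamma> ` {a<..a + int c}" for i
  proof -
    obtain x where "x \<in> \<gamma> -` {\<gamma> i}" "1 \<le> a + int c + 1 - x" "a + int c + 1 - x \<le> int c"
      using nearest_preceding[OF periodic_vimage[of "{\<gamma> i}"], of i "a + int c + 1"] c_pos by auto
    then show ?thesis by (intro image_eqI[of _ _ x]) auto
  qed
  then show ?thesis by auto
qed

lemma card_C_Int: "card (C \<inter> S) = card (\<gamma> -` S \<inter> {0<..int c})"
proof -
  have "C \<inter> S = \<gamma> ` {0<..int c} \<inter> S" using C_window[of 0] by simp
  then have "C \<inter> S = \<gamma> ` (\<gamma> -` S \<inter> {0<..int c})" by auto
  moreover have "inj_on \<gamma> (\<gamma> -` S \<inter> {0<..int c})" using inj[of 0] by (auto intro: inj_on_subset)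
  ultimately show ?thesis by (simp add: card_image)
qed

lemma seg_path:
  assumes "b - a < int c"
  shows "path (seg a b)"
proof -
  have "successively E (seg a b)"
    unfolding successively_conv_nth
  proof (intro allI impI)
    fix k assume "Suc k < length (seg a b)"
    then show "E (seg a b ! k) (seg a b ! Suc k)"
      using step[of "a + int k"] by (simp add: nth_upto algebra_simps)
  qed
  then show ?thesis
    unfolding path_def using inj_le[OF assms] C_V by (auto simp: distinct_map)
qed

lemma last_seg: "a \<le> b \<Longrightarrow> last (seg a b) = \<gamma> b"
  by (simp add: last_map upto_rec2)

lemma hd_seg: "a \<le> b \<Longrightarrow> hd (seg a b) = \<gamma> a"
  by (simp add: upto_rec1)

definition entering :: "'a list \<Rightarrow> bool" where
  "entering xs \<longleftrightarrow> path xs \<and> xs \<noteq> [] \<and> set xs \<inter> C = {} \<and> (\<exists>i. E (last xs) (\<gamma> i))"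

definition leaving :: "'a list \<Rightarrow> bool" where
  "leaving xs \<longleftrightarrow> path xs \<and> xs \<noteq> [] \<and> set xs \<inter> C = {} \<and> (\<exists>i. E (\<gamma> i) (hd xs))"

text \<open>Going from \<open>\<gamma> i\<close> to \<open>\<gamma> (i + g)\<close> through \<open>f\<close> instead of along the cycle makes \<open>\<gamma> (i + g)\<close> the end of two paths:
  one runs along the bypassed vertices, the other along the rest of the cycle and then through \<open>f\<close>. For empty
  \<open>f\<close> this is a chord of the cycle. The value \<open>g = c\<close> stands for \<open>f\<close> returning to where it left.\<close>

lemma ear_confluent:
  assumes "path f" "set f \<inter> C = {}" "f \<noteq> [] \<Longrightarrow> E (\<gamma> i) (hd f)"
    "E (last (\<gamma> i # f)) (\<gamma> (i + g))" "1 \<le> g" "g \<le> int c"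
  shows "confluent E (nat (g - 1)) (nat (int c - g) + length f)"
proof (rule confluentI[of _ "seg (i + 1) (i + g - 1)" "\<gamma> (i + g)" "seg (i + g + 1) (i + int c) @ f"])
  have "inj_on \<gamma> {i + 1..i + int c}" by (rule inj_le) simp
  moreover have "set ([i + 1..i + g - 1] @ [i + g + 1..i + int c] @ [i + g]) \<subseteq> {i + 1..i + int c}"
    using assms by auto
  moreover have "distinct ([i + 1..i + g - 1] @ [i + g + 1..i + int c] @ [i + g])" by auto
  ultimately have "distinct (map \<gamma> ([i + 1..i + g - 1] @ [i + g + 1..i + int c] @ [i + g]))"
    unfolding distinct_map by (blast intro: inj_on_subset)
  then show "distinct (seg (i + 1) (i + g - 1) @ (seg (i + g + 1) (i + int c) @ f) @ [\<gamma> (i + g)])"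
    using assms(1,2) by (auto simp: path_def)
  have "path (seg (i + 1) (i + g))" using assms by (intro seg_path) simp
  moreover have "[i + 1..i + g] = [i + 1..i + g - 1] @ [i + g]" using assms by (intro upto_rec2) simp
  ultimately show "successively E (seg (i + 1) (i + g - 1) @ [\<gamma> (i + g)])" by (simp add: path_def)
  have "path (seg (i + g + 1) (i + int c))" using assms by (intro seg_path) simp
  moreover have "last (seg (i + g + 1) (i + int c)) = \<gamma> i" if "g < int c"
    using that last_seg[of "i + g + 1" "i + int c"] period by simp
  ultimately show "successively E ((seg (i + g + 1) (i + int c) @ f) @ [\<gamma> (i + g)])"
    using assms(1,3,4)
    by (cases "g < int c"; cases "f = []") (auto simp: path_def successively_append_iff)
qed (use assms in auto)

text \<open>The bypassed vertices are replaced by \<open>f\<close>, which must not lengthen the cycle.\<close>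

lemma ear_length:
  assumes "path f" "f \<noteq> []" "set f \<inter> C = {}" "E (\<gamma> i) (hd f)" "E (last f) (\<gamma> (i + g))"
    "1 \<le> g" "g \<le> int c"
  shows "int (length f) < g"
proof -
  have p: "path (seg (i + g) (i + int c))" using assms by (intro seg_path) simp
  moreover have l: "last (seg (i + g) (i + int c)) = \<gamma> i"
    using last_seg[of "i + g" "i + int c"] assms(7) period by simp
  ultimately have "path (seg (i + g) (i + int c) @ f)"
    unfolding path_append using assms by auto
  moreover have "hd (seg (i + g) (i + int c)) = \<gamma> (i + g)" using assms(7) by (intro hd_seg) simp
  ultimately have "cycle (seg (i + g) (i + int c) @ f)"
    using assms by (auto simp: cycle_def)
  from longest[OF this] show ?thesis using assms by simp
qed

text \<open>The path is continued once around the cycle and then as far as possible. An arc from its final vertex back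
  into \<open>b\<close> would close a cycle containing \<open>C\<close> and a vertex of \<open>b\<close>. So this final vertex returns
  nowhere among the first \<open>length b\<close> vertices.\<close>

lemma entering_short:
  assumes "entering b"
  shows "length b + 1 < d"
proof -
  obtain i where b: "path b" "b \<noteq> []" "set b \<inter> C = {}" "E (last b) (\<gamma> i)"
    using assms by (auto simp: entering_def)
  let ?p = "b @ seg i (i + int c - 1)"
  have "path ?p"
    unfolding path_append using b seg_path[of "i + int c - 1" i] hd_seg[of i "i + int c - 1"] c_pos by auto
  then obtain zs where zs: "path (?p @ zs)" "\<And>u. E (last (?p @ zs)) u \<Longrightarrow> u \<in> set (?p @ zs)"
    using obtains_maximal_extension b(2) by (metis append_is_Nil_conv)
  define R where "R = ?p @ zs"
  have R: "path R" "R \<noteq> []" "drop (length b) R = seg i (i + int c - 1) @ zs"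
    using zs(1) b(2) by (auto simp: R_def)
  show ?thesis
  proof (rule stuck_end_returns_early[OF R(1,2)])
    fix u assume u: "E (last R) u"
    then obtain j where j: "j < length R" "R ! j = u"
      using zs(2) unfolding R_def by (metis in_set_conv_nth)
    have "length b \<le> j"
    proof (rule ccontr)
      assume early: "\<not> length b \<le> j"
      have "cycle (drop j R)" using cycle_drop[OF R(1) j(1)] u j(2) by simp
      from longest[OF this] have "length (drop j R) \<le> c" .
      then show False using early c_pos by (simp add: R_def)
    qed
    then show "u \<in> set (drop (length b) R)"
      using j by (auto simp: in_set_conv_nth intro!: exI[of _ "j - length b"])
  qed
qed

lemma Cons_path: "path xs \<Longrightarrow> xs \<noteq> [] \<Longrightarrow> E x (hd xs) \<Longrightarrow> x \<notin> set xs \<Longrightarrow> path (x # xs)"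
  using path_append[of "[x]" xs] arc_in_V by (auto simp: path_def)

lemma snoc_path: "path xs \<Longrightarrow> xs \<noteq> [] \<Longrightarrow> E (last xs) x \<Longrightarrow> x \<notin> set xs \<Longrightarrow> path (xs @ [x])"
  using path_append[of xs "[x]"] arc_in_V by (auto simp: path_def)

text \<open>The path \<open>b\<close> has fewer than \<open>d\<close> vertices, too few to contain all in-neighbours of its first vertex.\<close>

lemma longest_entering_leaves:
  assumes "entering b" and max: "\<And>xs. entering xs \<Longrightarrow> length xs \<le> length b"
  shows "{u. E u (hd b)} \<subseteq> set b \<union> C" "leaving b"
proof -
  obtain i where b: "path b" "b \<noteq> []" "set b \<inter> C = {}" "E (last b) (\<gamma> i)"
    using assms by (auto simp: entering_def)
  show sub: "{u. E u (hd b)} \<subseteq> set b \<union> C"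
  proof (rule subsetI, rule ccontr)
    fix u assume "u \<in> {u. E u (hd b)}" "u \<notin> set b \<union> C"
    then have "entering (u # b)" unfolding entering_def using b Cons_path[of b u] by auto
    from max[OF this] show False by simp
  qed
  have "hd b \<in> V" using b by (auto simp: path_def)
  then have "d \<le> card {u. E u (hd b)}" by (rule in_degree)
  moreover have "card (set b) < d" using entering_short[OF assms(1)] card_length[of b] by simp
  ultimately have "\<not> {u. E u (hd b)} \<subseteq> set b" using card_mono[of "set b" "{u. E u (hd b)}"] by auto
  then obtain k where "E (\<gamma> k) (hd b)" using sub by blast
  then show "leaving b" unfolding leaving_def using b by blast
qed

text \<open>A path that leaves the cycle and does not return, preceded by the whole cycle, has a stuck end that
  returns only to positions after the first \<open>c > d\<close> vertices.\<close>

lemma longest_leaving_enters: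
  assumes "leaving f" and max: "\<And>xs. leaving xs \<Longrightarrow> length xs \<le> length f"
  shows "{u. E (last f) u} \<subseteq> set f \<union> C" "entering f"
proof -
  obtain i where f: "path f" "f \<noteq> []" "set f \<inter> C = {}" "E (\<gamma> i) (hd f)"
    using assms by (auto simp: leaving_def)
  show sub: "{u. E (last f) u} \<subseteq> set f \<union> C"
  proof (rule subsetI, rule ccontr)
    fix u assume "u \<in> {u. E (last f) u}" "u \<notin> set f \<union> C"
    then have "leaving (f @ [u])" unfolding leaving_def using f snoc_path[of f u] by auto
    from max[OF this] show False by simp
  qed
  show "entering f"
  proof (rule ccontr)
    assume "\<not> entering f"
    then have inside: "u \<in> set f" if "E (last f) u" for u
      using sub that f unfolding entering_def by auto
    let ?R = "seg (i + 1) (i + int c) @ f"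
    have "path ?R" unfolding path_append
      using f seg_path[of "i + int c" "i + 1"] last_seg[of "i + 1" "i + int c"] c_pos period by auto
    then have "c + 1 < d" using f inside by (intro stuck_end_returns_early[of ?R c]) auto
    then show False using long by simp
  qed
qed

text \<open>A longest entering path also leaves and a longest leaving path also enters. So both have the same
  length, and a longest leaving path is closed at both ends.\<close>

lemma closed_ear_exists:
  assumes "E u v" "u \<in> C \<longleftrightarrow> v \<notin> C"
  obtains f where "path f" "f \<noteq> []" "set f \<inter> C = {}" "length f + 1 < d"
    "{u. E u (hd f)} \<subseteq> set f \<union> C" "{u. E (last f) u} \<subseteq> set f \<union> C"
proof -
  have longest_leaving: "\<exists>f. leaving f \<and> (\<forall>xs. leaving xs \<longrightarrow> length xs \<le> length f)" if "leaving x" for x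
  proof -
    have "path xs" if "leaving xs" for xs using that by (simp add: leaving_def)
    then obtain f where "leaving f" "\<And>xs. leaving xs \<Longrightarrow> length xs \<le> length f"
      using longest_exists[of leaving x "\<lambda>xs. xs"] \<open>leaving x\<close> by metis
    then show ?thesis by blast
  qed
  have longest_entering: "\<exists>f. entering f \<and> (\<forall>xs. entering xs \<longrightarrow> length xs \<le> length f)" if "entering x" for x
  proof -
    have "path xs" if "entering xs" for xs using that by (simp add: entering_def)
    then obtain f where "entering f" "\<And>xs. entering xs \<Longrightarrow> length xs \<le> length f"
      using longest_exists[of entering x "\<lambda>xs. xs"] \<open>entering x\<close> by metis
    then show ?thesis by blast
  qed
  have "\<exists>x. entering x"
  proof (cases "u \<in> C")
    case True
    then have "leaving [v]" using assms arc_in_V by (auto simp: leaving_def path_def)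
    then show ?thesis using longest_leaving longest_leaving_enters(2) by blast
  next
    case False
    then have "entering [u]" using assms arc_in_V by (auto simp: entering_def path_def)
    then show ?thesis by blast
  qed
  then obtain b where b: "entering b" "\<And>xs. entering xs \<Longrightarrow> length xs \<le> length b"
    using longest_entering by blast
  then obtain f where f: "leaving f" "\<And>xs. leaving xs \<Longrightarrow> length xs \<le> length f"
    using longest_leaving longest_entering_leaves(2) by blast
  have "length b \<le> length f" using f(2) longest_entering_leaves(2)[OF b] by blast
  moreover have ef: "entering f" by (rule longest_leaving_enters(2)[OF f])
  ultimately have max: "entering xs \<Longrightarrow> length xs \<le> length f" for xs using b(2) order_trans by blast
  show ?thesis
    by (rule that[of f])
      (use ef max entering_short[OF ef] longest_entering_leaves(1)[OF ef max]
        longest_leaving_enters(1)[OF f] in \<open>auto simp: entering_def\<close>)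
qed

end

section \<open>Two directed paths with a common end\<close>

context longest_cycle
begin

lemma entering_confluent:
  assumes "entering b"
  shows "confluent E (c - 1) (length b)"
proof -
  obtain i where b: "path b" "b \<noteq> []" "set b \<inter> C = {}" "E (last b) (\<gamma> i)"
    using assms by (auto simp: entering_def)
  have "path (seg (i + 1) (i + int c))" by (rule seg_path) simp
  moreover have "seg (i + 1) (i + int c) = seg (i + 1) (i + int c - 1) @ [\<gamma> i]"
    using c_pos period[of i] by (simp add: upto_rec2)
  ultimately have "path (seg (i + 1) (i + int c - 1) @ [\<gamma> i])" by simp
  then show ?thesis
    using b by (intro confluentI[of _ "seg (i + 1) (i + int c - 1)" "\<gamma> i" b])
      (auto simp: path_def successively_append_iff)
qed

text \<open>Otherwise all at least \<open>2 * d\<close> neighbours of \<open>\<gamma> 0\<close> are on the cycle. A chord from \<open>\<gamma> 0\<close> to \<open>\<gamma> g\<close> gives confluent lengths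
  \<open>g - 1\<close> and \<open>c - g\<close>, a chord from \<open>\<gamma> g\<close> to \<open>\<gamma> 0\<close> gives \<open>c - g - 1\<close> and \<open>g\<close>. Both exclude nearly the same values
  of \<open>g\<close>, which leaves fewer than \<open>2 * d\<close> of them. Since no pair of vertices is joined in both directions,
  the positions of in- and out-neighbours are distinct.\<close>

lemma some_arc_crosses: "\<exists>u v. E u v \<and> (u \<in> C \<longleftrightarrow> v \<notin> C)"
proof (rule ccontr)
  assume closed: "\<not> ?thesis"
  define P where "P = \<gamma> -` {u. E (\<gamma> 0) u} \<inter> {0<..int c}"
  define N where "N = \<gamma> -` {u. E u (\<gamma> 0)} \<inter> {0<..int c}"
  have c0: "\<gamma> (int c) = \<gamma> 0" using period[of 0] by simp
  have "{u. E (\<gamma> 0) u} \<subseteq> C" "{u. E u (\<gamma> 0)} \<subseteq> C" using closed by blast+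
  then have "C \<inter> {u. E (\<gamma> 0) u} = {u. E (\<gamma> 0) u}" "C \<inter> {u. E u (\<gamma> 0)} = {u. E u (\<gamma> 0)}" by auto
  moreover have "\<gamma> 0 \<in> V" using C_V by auto
  ultimately have "d \<le> card P" "d \<le> card N"
    using card_C_Int[of "{u. E (\<gamma> 0) u}"] card_C_Int[of "{u. E u (\<gamma> 0)}"]
      out_degree[of "\<gamma> 0"] in_degree[of "\<gamma> 0"] by (auto simp: P_def N_def)
  moreover have "P \<inter> N = {}" using asym by (auto simp: P_def N_def)
  moreover have "finite P" "finite N" by (auto simp: P_def N_def)
  ultimately have big: "2 * d \<le> card (P \<union> N)" by (simp add: card_Un_disjoint)
  have ne: "g \<noteq> int c" if "g \<in> P \<union> N" for g
    using that asym[of "\<gamma> 0" "\<gamma> 0"] c0 by (auto simp: P_def N_def)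
  have "P \<union> N \<subseteq> {1..int c - 1}" using ne by (auto simp: P_def N_def) (smt (verit))+
  then have "card (P \<union> N) \<le> card {1..int c - 1}" by (rule card_mono[rotated]) simp
  then have "2 * d < c" using big c_pos by simp
  have "g \<in> {1..int t} \<union> {int c - int s..int s} \<union> {int c - int t..int c - 1}" if mem: "g \<in> P \<union> N" for g
  proof -
    have g: "1 \<le> g" "g \<le> int c - 1" using mem ne[OF mem] by (auto simp: P_def N_def)
    have chord: "confluent E (nat (h - 1)) (nat (int c - h))"
      if "E (\<gamma> i) (\<gamma> (i + h))" "1 \<le> h" "h \<le> int c" for i h
      using ear_confluent[of "[]" i h] that by (simp add: path_def)
    consider "E (\<gamma> 0) (\<gamma> (0 + g))" | "E (\<gamma> g) (\<gamma> (g + (int c - g)))"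
      using mem c0 by (auto simp: P_def N_def)
    then show ?thesis
    proof cases
      case 1
      from not_confluent[OF chord[OF this]] g show ?thesis by auto
    next
      case 2
      from not_confluent[OF chord[OF this]] g show ?thesis by auto
    qed
  qed
  then have "P \<union> N \<subseteq> {1..int t} \<union> {int c - int s..int s} \<union> {int c - int t..int c - 1}" by blast
  then have "card (P \<union> N) \<le> card ({1..int t} \<union> {int c - int s..int s} \<union> {int c - int t..int c - 1})"
    by (rule card_mono[rotated]) simp
  also have "\<dots> \<le> card ({1..int t} \<union> {int c - int s..int s}) + card {int c - int t..int c - 1}"
    by (rule card_Un_le)
  also have "\<dots> \<le> card {1..int t} + card {int c - int s..int s} + card {int c - int t..int c - 1}"
    using card_Un_le[of "{1..int t}" "{int c - int s..int s}"] by simp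
  also have "\<dots> < 2 * d" using \<open>2 * d < c\<close> sum_st t_less by auto
  finally show False using big by simp
qed

text \<open>Each end of a closed ear \<open>f\<close> with \<open>q\<close> vertices has at most \<open>q - 1\<close> neighbours in the ear, so at least
  \<open>2 * d - 2 * q + 2\<close> arcs go from the cycle to its first or from its last vertex to the cycle. For \<open>s < c\<close>
  the forbidden differences \<open>1, \<dots>, q\<close> and \<open>t + 1, \<dots>, c + q - s\<close> leave room for one arc less. For \<open>c \<le> s\<close> at
  most \<open>s - c + t - 1\<close> vertices of the ear can receive an arc from its last one, since other such arcs
  give confluent pairs; this leaves too many arcs to the cycle for the first interval.\<close>

lemma inconsistent: False
proof -
  obtain f where f: "path f" "f \<noteq> []" "set f \<inter> C = {}" "length f + 1 < d"
    and into: "{u. E u (hd f)} \<subseteq> set f \<union> C" and out_of: "{u. E (last f) u} \<subseteq> set f \<union> C"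
    using some_arc_crosses closed_ear_exists by metis
  define q where "q = length f"
  have q: "1 \<le> q" "q + 1 < d" using f(2,4) by (auto simp: q_def Suc_le_eq)
  define X where "X = \<gamma> -` {u. E u (hd f)}"
  define Y where "Y = \<gamma> -` {u. E (last f) u}"
  let ?X = "X \<inter> {0<..int c}" and ?Y = "Y \<inter> {0<..int c}"
  have per: "periodic (int c) X" "periodic (int c) Y" unfolding X_def Y_def by (rule periodic_vimage)+
  have ends: "hd f \<in> set f" "last f \<in> set f" using f(2) by auto
  then have endsV: "hd f \<in> V" "last f \<in> V" using f(1) by (auto simp: path_def)
  have card_f: "card (set f - {v}) = q - 1" if "v \<in> set f" for v
    using that f(1) by (simp add: q_def path_def distinct_card)
  have X_large: "d + 1 \<le> card ?X + q"
  proof -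
    have "{u. E u (hd f)} \<subseteq> (set f - {hd f}) \<union> (C \<inter> {u. E u (hd f)})" using into asym by blast
    moreover have "finite (C \<inter> {u. E u (hd f)})" using finite_in by blast
    ultimately have "card {u. E u (hd f)} \<le> card ((set f - {hd f}) \<union> (C \<inter> {u. E u (hd f)}))"
      by (intro card_mono) auto
    also have "\<dots> \<le> q - 1 + card ?X"
      using card_Un_le[of "set f - {hd f}"] card_f[OF ends(1)] card_C_Int by (metis X_def)
    finally show ?thesis using in_degree[OF endsV(1)] q by simp
  qed
  have Y_large: "d \<le> card J + card ?Y" if "\<And>j. j < q \<Longrightarrow> E (last f) (f ! j) \<Longrightarrow> j \<in> J" "finite J" for J
  proof -
    have "{u. E (last f) u} \<subseteq> (!) f ` J \<union> (C \<inter> {u. E (last f) u})"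
    proof
      fix u assume u: "u \<in> {u. E (last f) u}"
      show "u \<in> (!) f ` J \<union> (C \<inter> {u. E (last f) u})"
      proof (cases "u \<in> set f")
        case True
        then obtain j where "j < q" "u = f ! j" by (auto simp: in_set_conv_nth q_def)
        then show ?thesis using that(1)[of j] u by auto
      qed (use u out_of in auto)
    qed
    moreover have "finite (C \<inter> {u. E (last f) u})" using finite_out by blast
    ultimately have "card {u. E (last f) u} \<le> card ((!) f ` J \<union> (C \<inter> {u. E (last f) u}))"
      using that(2) by (intro card_mono) auto
    also have "\<dots> \<le> card ((!) f ` J) + card ?Y"
      using card_Un_le[of "(!) f ` J"] card_C_Int by (metis Y_def)
    also have "\<dots> \<le> card J + card ?Y" using card_image_le[OF that(2)] by simp
    finally show ?thesis using out_degree[OF endsV(2)] by simp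
  qed
  have last_f: "j \<noteq> q - 1" if "E (last f) (f ! j)" for j
    using that asym f(2) by (auto simp: q_def last_conv_nth)
  have "d + 1 \<le> card ?Y + q"
    using Y_large[of "{..<q - 1}"] last_f q by force
  then have "?X \<noteq> {}" "?Y \<noteq> {}" using X_large q by auto
  then obtain x y where x: "x \<in> X" and y: "y \<in> Y" by blast
  then have ne: "X \<noteq> {}" "Y \<noteq> {}" by auto
  have ear: "int q < g" "confluent E (nat (g - 1)) (nat (int c - g) + q)"
    if "x \<in> X" "x + g \<in> Y" "1 \<le> g" "g \<le> int c" for x g
    using ear_length[OF f(1-3), of x g] ear_confluent[OF f(1,3), of x g] f(2) that
    by (auto simp: X_def Y_def q_def)
  have near: "x + g \<notin> Y" if "x \<in> X" "1 \<le> g" "g \<le> int q" for x g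
    using ear(1)[of x g] that q long by auto
  have sumset: "int (card ?X) + int (card ?Y) \<le> int c - int q + 1"
    using one_interval[OF per _ _ ne near] q c_pos by simp
  \<comment> \<open>In particular the cycle and the ear together are long, so that the second interval is nonempty.\<close>
  then have cq: "2 * d + 1 \<le> c + q" using X_large \<open>d + 1 \<le> card ?Y + q\<close> by linarith
  show False
  proof (cases "c \<le> s")
    case True
    \<comment> \<open>The cycle followed by the ear is a path on which \<open>f ! j\<close> has position \<open>c + j\<close>; an arc back to it gives
      confluent lengths \<open>c + j\<close> and \<open>q - 1 - j\<close>.\<close>
    have "j \<in> {..<s - c} \<union> {q - t..<q - 1}" if "j < q" "E (last f) (f ! j)" for j
    proof -
      let ?R = "seg (x + 1) (x + int c) @ f"
      have "path ?R" unfolding path_append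
        using f seg_path[of "x + int c" "x + 1"] last_seg[of "x + 1" "x + int c"] c_pos period x
        by (auto simp: X_def)
      from not_confluent(1)[OF confluent_back_arc[OF this, of "c + j"]] that f(2)
      have "\<not> (s \<le> c + j \<and> t \<le> q - 1 - j)" by (auto simp: q_def nth_append)
      then show ?thesis using last_f[OF that(2)] that(1) by auto
    qed
    then have "d \<le> card ({..<s - c} \<union> {q - t..<q - 1}) + card ?Y" by (intro Y_large) auto
    also have "\<dots> \<le> card {..<s - c} + card {q - t..<q - 1} + card ?Y"
      using card_Un_le[of "{..<s - c}" "{q - t..<q - 1}"] by simp
    finally have "d \<le> (s - c) + (q - 1 - (q - t)) + card ?Y" by simp
    then show False using sumset X_large True cq sum_st by linarith
  next
    case False
    have "entering f" using f y by (auto simp: entering_def Y_def)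
    \<comment> \<open>The whole cycle is a branch of length \<open>c - 1 \<ge> s\<close>, so the ear is too short for the other one.\<close>
    from not_confluent(1)[OF entering_confluent[OF this]] False have "q < t"
      by (auto simp: q_def)
    have "int (card ?X) + int (card ?Y) \<le> int c - int q - (int c + int q - int s - int t) + 2"
    proof (rule two_intervals[OF per _ _ _ _ _ ne near])
      show "x + g \<notin> Y" if "x \<in> X" "int t + 1 \<le> g" "g \<le> int t + (int c + int q - int s - int t)" for x g
      proof
        assume "x + g \<in> Y"
        then have "confluent E (nat (g - 1)) (nat (int c - g) + q)"
          using that \<open>q < t\<close> sum_st t_less by (intro ear(2)) auto
        from not_confluent(2)[OF this] that \<open>q < t\<close> sum_st t_less show False by auto
      qed
    qed (use q c_pos cq sum_st \<open>q < t\<close> t_less in auto)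
    then show False using X_large \<open>d + 1 \<le> card ?Y + q\<close> sum_st by linarith
  qed
qed

end

context semidegree_digraph
begin

lemma confluent_critical:
  assumes "1 \<le> t" "t < d" "s + t + 1 = 2 * d"
  shows "confluent E s t"
proof (rule ccontr)
  assume "\<not> confluent E s t"
  then interpret no_confluent_paths V E d s t using assms by unfold_locales
  obtain ys where ys: "cycle ys" "d < length ys" using cycle_exists assms by auto
  obtain xs where xs: "cycle xs" "\<And>ys. cycle ys \<Longrightarrow> length ys \<le> length xs"
    using longest_exists[of cycle ys "\<lambda>xs. xs"] ys(1) by (auto simp: cycle_def)
  have "d < length xs" using xs(2)[OF ys(1)] ys(2) by simp
  define n where "n = int (length xs)"
  have "0 < n" using \<open>d < length xs\<close> by (cases xs) (auto simp: n_def)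
  define \<gamma> where "\<gamma> i = xs ! nat (i mod n)" for i
  have idx: "nat (i mod n) < length xs" for i
    using \<open>0 < n\<close> pos_mod_bound[of n i] pos_mod_sign[of n i] by (simp add: n_def nat_less_iff)
  interpret longest_cycle V E d s t \<gamma> "length xs"
  proof
    show "\<gamma> (i + int (length xs)) = \<gamma> i" for i by (simp add: \<gamma>_def n_def)
    show "length ys \<le> length xs" if "cycle ys" for ys using xs(2)[OF that] .
    show "d < length xs" by fact
    show "inj_on \<gamma> {a<..a + int (length xs)}" for a
    proof (rule inj_onI)
      fix i j assume ij: "i \<in> {a<..a + int (length xs)}" "j \<in> {a<..a + int (length xs)}" "\<gamma> i = \<gamma> j"
      have "nat (i mod n) = nat (j mod n)"
        using ij(3) idx[of i] idx[of j] xs(1) by (simp add: \<gamma>_def cycle_def path_def nth_eq_iff_index_eq)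
      then have "i mod n = j mod n" using pos_mod_sign[OF \<open>0 < n\<close>] by (metis int_nat_eq)
      then have "n dvd i - j" by (simp add: mod_eq_dvd_iff)
      moreover have "\<bar>i - j\<bar> < n" using ij by (auto simp: n_def)
      ultimately show "i = j" using dvd_imp_le_int[of "i - j" n] \<open>0 < n\<close> by auto
    qed
    show "E (\<gamma> i) (\<gamma> (i + 1))" for i
    proof (cases "i mod n + 1 < n")
      case True
      then have "(i + 1) mod n = i mod n + 1"
        using pos_mod_sign[OF \<open>0 < n\<close>, of i] by (metis mod_add_left_eq mod_pos_pos_trivial add_nonneg_nonneg zero_le_one)
      then have "nat ((i + 1) mod n) = Suc (nat (i mod n))"
        using pos_mod_sign[OF \<open>0 < n\<close>, of i] by (simp add: nat_add_distrib)
      then show ?thesis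
        using xs(1) idx[of "i + 1"] by (simp add: \<gamma>_def cycle_def path_def successively_nth)
    next
      case False
      then have "i mod n = n - 1" using pos_mod_bound[OF \<open>0 < n\<close>, of i] by simp
      moreover from this have "(i + 1) mod n = 0" by (metis mod_add_left_eq diff_add_cancel mod_self)
      moreover have "nat (n - 1) = length xs - 1" by (simp add: n_def)
      ultimately show ?thesis
        using xs(1) last_conv_nth[of xs] hd_conv_nth[of xs] by (auto simp: \<gamma>_def cycle_def)
    qed
  qed
  show False by (rule inconsistent)
qed

lemma confluent_paths:
  assumes "1 \<le> s" "1 \<le> t" "s + t < 2 * d"
  shows "confluent E s t"
proof (cases "t \<le> s")
  case True
  then have "confluent E (2 * d - 1 - t) t" using assms by (intro confluent_critical) auto
  then show ?thesis by (rule confluent_mono) (use assms in auto)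
next
  case False
  then have "confluent E (2 * d - 1 - s) s" using assms by (intro confluent_critical) auto
  from confluent_commute[OF this] show ?thesis by (rule confluent_mono) (use assms in auto)
qed

end

section \<open>Blocks of an oriented path\<close>

lemma crossing_step:
  assumes "a \<in> set zs" "b \<in> set zs" "Q a \<noteq> Q b"
  shows "\<exists>r. Suc r < length zs \<and> Q (zs ! r) \<noteq> Q (zs ! Suc r)"
proof (rule ccontr)
  assume "\<not> ?thesis"
  then have "r < length zs \<Longrightarrow> Q (zs ! r) = Q (zs ! 0)" for r
    by (induction r) auto
  then show False using assms by (metis in_set_conv_nth)
qed

locale enumerated_path = oriented_graph P for P :: "('c, 'd) pre_digraph" +
  fixes us :: "'c list"
  assumes distinct_us: "distinct us" and set_us: "set us = verts P"
    and adjacent_iff: "(u \<rightarrow>\<^bsub>P\<^esub> v \<or> v \<rightarrow>\<^bsub>P\<^esub> u) \<longleftrightarrow> (\<exists>i. Suc i < length us \<and> {u, v} = {us ! i, us ! Suc i})"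
begin

definition at_edge :: "'d \<Rightarrow> nat \<Rightarrow> bool" where
  "at_edge e i \<longleftrightarrow> e \<in> arcs P \<and> Suc i < length us \<and> {tail P e, head P e} = {us ! i, us ! Suc i}"

definition forward :: "nat \<Rightarrow> bool" where
  "forward i \<longleftrightarrow> us ! i \<rightarrow>\<^bsub>P\<^esub> us ! Suc i"

lemma arc_dominates: "e \<in> arcs P \<Longrightarrow> tail P e \<rightarrow>\<^bsub>P\<^esub> head P e"
  by (rule dominatesI) (simp_all add: arc_to_ends_def)

lemma arc_at_edge: "e \<in> arcs P \<Longrightarrow> \<exists>i. at_edge e i"
  using adjacent_iff[of "tail P e" "head P e"] arc_dominates[of e] unfolding at_edge_def by blast

lemma edge_has_arc:
  assumes "Suc i < length us"
  shows "\<exists>e. at_edge e i"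
proof -
  have "us ! i \<rightarrow>\<^bsub>P\<^esub> us ! Suc i \<or> us ! Suc i \<rightarrow>\<^bsub>P\<^esub> us ! i"
    using adjacent_iff[of "us ! i" "us ! Suc i"] assms by blast
  then obtain e where "e \<in> arcs P"
    "tail P e = us ! i \<and> head P e = us ! Suc i \<or> tail P e = us ! Suc i \<and> head P e = us ! i"
    by blast
  then have "at_edge e i" unfolding at_edge_def using assms by auto
  then show ?thesis ..
qed

lemma us_eq: "i < length us \<Longrightarrow> j < length us \<Longrightarrow> us ! i = us ! j \<longleftrightarrow> i = j"
  using distinct_us by (rule nth_eq_iff_index_eq)

lemma at_edge_index_unique: "at_edge e i \<Longrightarrow> at_edge e j \<Longrightarrow> i = j"
  by (auto simp: at_edge_def doubleton_eq_iff us_eq)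

lemma at_edge_unique:
  assumes "at_edge e i" "at_edge f i"
  shows "e = f"
proof -
  have ends: "e \<in> arcs P" "f \<in> arcs P" "{tail P e, head P e} = {tail P f, head P f}"
    using assms by (auto simp: at_edge_def)
  moreover have "\<not> (tail P e = head P f \<and> head P e = tail P f)"
    using no_two_cycle[OF arc_dominates[OF ends(1)]] arc_dominates[OF ends(2)] by auto
  ultimately show ?thesis
    by (intro no_multi_arcs) (auto simp: doubleton_eq_iff arc_to_ends_def)
qed

lemma length_us: "length us = Suc (card (arcs P))"
proof -
  obtain a where a: "\<And>i. Suc i < length us \<Longrightarrow> at_edge (a i) i" using edge_has_arc by metis
  have "bij_betw a {i. Suc i < length us} (arcs P)"
  proof (rule bij_betw_imageI)
    show "inj_on a {i. Suc i < length us}"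
      using a at_edge_index_unique by (metis (mono_tags, lifting) inj_onI mem_Collect_eq)
    show "a ` {i. Suc i < length us} = arcs P"
    proof (intro equalityI subsetI)
      fix e assume "e \<in> arcs P"
      then obtain i where "at_edge e i" using arc_at_edge by blast
      then show "e \<in> a ` {i. Suc i < length us}"
        using a[of i] at_edge_unique by (auto simp: at_edge_def intro!: image_eqI[of _ _ i])
    qed (use a in \<open>auto simp: at_edge_def\<close>)
  qed
  then have "card {i. Suc i < length us} = card (arcs P)" by (rule bij_betw_same_card)
  moreover have "{i. Suc i < length us} = {..<length us - 1}" by auto
  moreover have "us \<noteq> []" using verts_nonempty set_us by auto
  ultimately show ?thesis by (cases us) auto
qed

lemma at_edge_orientation:
  assumes "at_edge e i"
  shows "if forward i then tail P e = us ! i \<and> head P e = us ! Suc i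
    else tail P e = us ! Suc i \<and> head P e = us ! i"
proof -
  have "e \<in> arcs P" "{tail P e, head P e} = {us ! i, us ! Suc i}" using assms by (auto simp: at_edge_def)
  then show ?thesis
    using arc_dominates[of e] no_two_cycle[of "us ! i" "us ! Suc i"]
    by (auto simp: forward_def doubleton_eq_iff)
qed

lemma oriented_path_P: "oriented_path P"
  unfolding oriented_path_def using distinct_us set_us adjacent_iff oriented_graph_axioms by blast

lemma directed_if_constant:
  assumes const: "\<And>i. Suc i < length us \<Longrightarrow> forward i = b"
  shows "directed_path P"
  unfolding directed_path_def
proof (intro conjI ballI impI oriented_path_P)
  fix e f assume "e \<in> arcs P" "f \<in> arcs P"
    and meet: "e \<noteq> f \<and> {tail P e, head P e} \<inter> {tail P f, head P f} \<noteq> {}"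
  then obtain i j where ij: "at_edge e i" "at_edge f j" using arc_at_edge by meson
  then have "i \<noteq> j" using meet at_edge_unique by blast
  have len: "Suc i < length us" "Suc j < length us" using ij by (auto simp: at_edge_def)
  have "{us ! i, us ! Suc i} \<inter> {us ! j, us ! Suc j} \<noteq> {}"
    using meet ij unfolding at_edge_def by metis
  then have "j = Suc i \<or> i = Suc j" using len \<open>i \<noteq> j\<close> by (auto simp: us_eq)
  then show "head P e = tail P f \<or> head P f = tail P e"
    using at_edge_orientation[OF ij(1)] at_edge_orientation[OF ij(2)] const[OF len(1)] const[OF len(2)]
    by (cases b) auto
qed

lemma subgraph_self: "subgraph P P"
  by (simp add: subgraph_def compatible_def wf_digraph)

lemma blocks_directed:
  assumes "directed_path P"
  shows "blocks P = {P}"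
proof (intro equalityI subsetI)
  fix B assume "B \<in> blocks P"
  then have "subgraph B P" "\<forall>H. H \<noteq> B \<and> subgraph B H \<longrightarrow> \<not> (subgraph H P \<and> directed_path H)"
    by (auto simp: blocks_def pre_digraph.max_subgraph_def)
  then have "P = B" using assms subgraph_self by (metis (no_types))
  then show "B \<in> {P}" by simp
next
  have "H = P" if "subgraph P H" "subgraph H P" for H
    using that by (auto simp: subgraph_def compatible_def intro: pre_digraph.equality)
  then show "B \<in> blocks P" if "B \<in> {P}" for B
    using that assms subgraph_self by (auto simp: blocks_def pre_digraph.max_subgraph_def)
qed

text \<open>A single arc is a directed path, and finiteness gives a maximal directed subpath containing it.\<close>

lemma arc_in_block:
  assumes e: "e \<in> arcs P"
  shows "\<exists>B \<in> blocks P. e \<in> arcs B"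
proof -
  let ?Q = "\<lambda>H. subgraph H P \<and> directed_path H \<and> e \<in> arcs H"
  let ?size = "\<lambda>H. card (verts H) + card (arcs H)"
  define A where "A = \<lparr>verts = {tail P e, head P e}, arcs = {e}, tail = tail P, head = head P\<rparr>"
  have ne: "tail P e \<noteq> head P e" using no_loops[OF e] .
  interpret A: oriented_graph A
    by unfold_locales (use ne in \<open>auto simp: A_def arcs_ends_conv\<close>)
  have "enumerated_path A [tail P e, head P e]"
  proof
    show "(u \<rightarrow>\<^bsub>A\<^esub> v \<or> v \<rightarrow>\<^bsub>A\<^esub> u) \<longleftrightarrow>
      (\<exists>i. Suc i < length [tail P e, head P e] \<and> {u, v} = {[tail P e, head P e] ! i, [tail P e, head P e] ! Suc i})" for u v
      by (auto simp: A_def arcs_ends_conv doubleton_eq_iff)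
  qed (use ne in \<open>auto simp: A_def\<close>)
  then have "directed_path A"
    using enumerated_path.directed_if_constant[of A _ "enumerated_path.forward A [tail P e, head P e] 0"] by fastforce
  moreover have "subgraph A P"
    using e A.wf_digraph wf_digraph by (auto simp: subgraph_def compatible_def A_def)
  ultimately have "?Q A" by (simp add: A_def)
  moreover have "\<forall>H. ?Q H \<longrightarrow> ?size H < Suc (card (verts P) + card (arcs P))"
    by (auto simp: less_Suc_eq_le subgraph_def intro!: add_mono card_mono)
  ultimately obtain B where B: "?Q B" "\<forall>H. ?Q H \<longrightarrow> ?size H \<le> ?size B"
    using ex_has_greatest_nat[of ?Q A ?size] by blast
  have "H = B" if H: "subgraph B H" "subgraph H P" "directed_path H" for H
  proof -
    have sub: "verts B \<subseteq> verts H" "arcs B \<subseteq> arcs H" "compatible H B"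
      using H(1) by (auto simp: subgraph_def)
    have fin: "finite (verts H)" "finite (arcs H)"
      using H(2) by (auto simp: subgraph_def intro: finite_subset[OF _ finite_verts] finite_subset[OF _ finite_arcs])
    have "?size H \<le> ?size B" using B H sub by auto
    moreover have "card (verts B) \<le> card (verts H)" "card (arcs B) \<le> card (arcs H)"
      using sub fin by (auto intro: card_mono)
    ultimately have "card (verts B) = card (verts H)" "card (arcs B) = card (arcs H)" by linarith+
    then have "verts B = verts H" "arcs B = arcs H"
      using card_subset_eq fin sub(1,2) by blast+
    then show ?thesis using sub(3) by (auto simp: compatible_def intro: pre_digraph.equality)
  qed
  then have "B \<in> blocks P" using B(1) by (auto simp: blocks_def pre_digraph.max_subgraph_def)
  then show ?thesis using B(1) by blast
qed

text \<open>The subpath has its own enumeration \<open>zs\<close> of vertices. Along \<open>zs\<close> the position in \<open>us\<close> passes from at most \<open>m\<close>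
  to more than \<open>m\<close>. The step of \<open>zs\<close> where this happens is an edge of the whole path, which can only be the
  one between \<open>us ! m\<close> and \<open>us ! Suc m\<close>.\<close>

lemma directed_subpath_interval:
  assumes B: "subgraph B P" "directed_path B"
    and ef: "e \<in> arcs B" "f \<in> arcs B" "at_edge e i" "at_edge f j" and m: "i \<le> m" "m \<le> j"
    and g: "at_edge g m"
  shows "g \<in> arcs B"
proof -
  have sub: "arcs B \<subseteq> arcs P" "tail B = tail P" "head B = head P" "wf_digraph B"
    using B(1) by (auto simp: subgraph_def compatible_def)
  obtain zs where zs: "set zs = verts B"
    "\<And>u v. (u \<rightarrow>\<^bsub>B\<^esub> v \<or> v \<rightarrow>\<^bsub>B\<^esub> u) \<longleftrightarrow> (\<exists>r. Suc r < length zs \<and> {u, v} = {zs ! r, zs ! Suc r})"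
    using B(2) unfolding directed_path_def oriented_path_def by blast
  define Q where "Q v \<longleftrightarrow> (\<exists>l\<le>m. v = us ! l)" for v
  have Q: "Q (us ! l) \<longleftrightarrow> l \<le> m" if "l < length us" for l
    unfolding Q_def using that g by (auto simp: at_edge_def us_eq)
  have "{us ! i, us ! Suc i} \<subseteq> verts B" "{us ! j, us ! Suc j} \<subseteq> verts B"
    using ef sub wf_digraph.tail_in_verts[OF sub(4)] wf_digraph.head_in_verts[OF sub(4)]
    unfolding at_edge_def by (metis empty_subsetI insert_subset)+
  then have "us ! i \<in> set zs" "us ! Suc j \<in> set zs" using zs(1) by auto
  moreover have "Q (us ! i)" "\<not> Q (us ! Suc j)" using Q ef m by (auto simp: at_edge_def)
  ultimately obtain r where r: "Suc r < length zs" "Q (zs ! r) \<noteq> Q (zs ! Suc r)"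
    using crossing_step[of "us ! i" zs "us ! Suc j" Q] by auto
  obtain h where h: "h \<in> arcs B" "{tail P h, head P h} = {zs ! r, zs ! Suc r}"
  proof -
    have "zs ! r \<rightarrow>\<^bsub>B\<^esub> zs ! Suc r \<or> zs ! Suc r \<rightarrow>\<^bsub>B\<^esub> zs ! r" using zs(2) r(1) by blast
    then obtain h where "h \<in> arcs B"
      "tail B h = zs ! r \<and> head B h = zs ! Suc r \<or> tail B h = zs ! Suc r \<and> head B h = zs ! r"
      by blast
    then show ?thesis using that[of h] sub by (auto simp: doubleton_eq_iff)
  qed
  then obtain l where l: "at_edge h l" using arc_at_edge sub by blast
  then have "{zs ! r, zs ! Suc r} = {us ! l, us ! Suc l}" "Suc l < length us"
    using h by (auto simp: at_edge_def)
  then have "Q (us ! l) \<noteq> Q (us ! Suc l)" using r(2) by (auto simp: doubleton_eq_iff)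
  then have "l = m" using Q \<open>Suc l < length us\<close> by auto
  then show ?thesis using at_edge_unique g l h(1) by blast
qed

lemma directed_subpath_no_turn:
  assumes B: "subgraph B P" "directed_path B"
    and ef: "e \<in> arcs B" "f \<in> arcs B" "at_edge e i" "at_edge f j" and m: "i \<le> m" "Suc m \<le> j"
  shows "forward m = forward (Suc m)"
proof -
  have "Suc (Suc m) < length us" using ef m by (auto simp: at_edge_def)
  then obtain g h where gh: "at_edge g m" "at_edge h (Suc m)" using edge_has_arc by (meson Suc_lessD)
  then have "g \<in> arcs B" "h \<in> arcs B"
    using directed_subpath_interval[OF B ef _ _ gh(1)] directed_subpath_interval[OF B ef _ _ gh(2)] m
    by auto
  moreover have "g \<noteq> h" using at_edge_index_unique[of g m "Suc m"] gh by auto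
  moreover have "us ! Suc m \<in> {tail B g, head B g} \<inter> {tail B h, head B h}"
    using gh B(1) by (auto simp: at_edge_def subgraph_def compatible_def)
  ultimately have "head B g = tail B h \<or> head B h = tail B g"
    using B(2) unfolding directed_path_def by blast
  then have "head P g = tail P h \<or> head P h = tail P g"
    using B(1) by (simp add: subgraph_def compatible_def)
  then show ?thesis
    using at_edge_orientation[OF gh(1)] at_edge_orientation[OF gh(2)] \<open>Suc (Suc m) < length us\<close>
    by (auto simp: us_eq split: if_splits)
qed

text \<open>The arcs at the edges \<open>i\<close>, \<open>j\<close> and \<open>Suc j\<close> are pairwise separated by a change of orientation, so their
  blocks differ.\<close>

lemma two_turns_three_blocks:
  assumes "i < j" "Suc (Suc j) < length us" "forward i \<noteq> forward (Suc i)" "forward j \<noteq> forward (Suc j)"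
  shows "card (blocks P) \<noteq> 2"
proof
  assume two: "card (blocks P) = 2"
  obtain e f g where at: "at_edge e i" "at_edge f j" "at_edge g (Suc j)"
    using edge_has_arc assms by (meson Suc_lessD less_trans_Suc)
  obtain A B C where blk: "A \<in> blocks P" "B \<in> blocks P" "C \<in> blocks P"
    and mem: "e \<in> arcs A" "f \<in> arcs B" "g \<in> arcs C"
    using arc_in_block at unfolding at_edge_def by metis
  have dir: "subgraph H P \<and> directed_path H" if "H \<in> blocks P" for H
    using that by (auto simp: blocks_def pre_digraph.max_subgraph_def)
  have "A \<noteq> B" "A \<noteq> C"
    using directed_subpath_no_turn[of A e f i j i] directed_subpath_no_turn[of A e g i "Suc j" i]
      dir[OF blk(1)] mem at assms by auto
  moreover have "B \<noteq> C"
    using directed_subpath_no_turn[of B f g j "Suc j" j] dir[OF blk(2)] mem at assms by auto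
  ultimately have "card {A, B, C} = 3" by simp
  moreover have "card {A, B, C} \<le> card (blocks P)"
    using blk two by (intro card_mono card_ge_0_finite) auto
  ultimately show False using two by simp
qed

lemma two_blocks_one_turn:
  assumes "card (blocks P) = 2"
  obtains m where "Suc (Suc m) < length us"
    "\<And>i. Suc i < length us \<Longrightarrow> forward i \<longleftrightarrow> (forward 0 \<longleftrightarrow> i \<le> m)"
proof -
  have "\<exists>m. Suc (Suc m) < length us \<and> forward m \<noteq> forward (Suc m)"
  proof (rule ccontr)
    assume "\<not> ?thesis"
    then have "Suc i < length us \<Longrightarrow> forward i = forward 0" for i by (induction i) auto
    from directed_if_constant[OF this] have "card (blocks P) = 1" using blocks_directed by simp
    then show False using assms by simp
  qed
  then obtain m where m: "Suc (Suc m) < length us" "forward m \<noteq> forward (Suc m)" by blast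
  have other: "forward i = forward (Suc i)" if "i \<noteq> m" "Suc (Suc i) < length us" for i
    using two_turns_three_blocks[of i m] two_turns_three_blocks[of m i] m that assms by (cases "i < m") auto
  have "Suc i < length us \<Longrightarrow> forward i \<longleftrightarrow> (forward 0 \<longleftrightarrow> i \<le> m)" for i
  proof (induction i)
    case (Suc i)
    then show ?case using other[of i] m by (cases "i = m") (auto simp: not_less_eq_eq)
  qed simp
  then show ?thesis using that m(1) by blast
qed

end

section \<open>Embedding the path\<close>

lemma contains_if_embedding:
  assumes "digraph P" "wf_digraph D" "inj_on \<phi> (verts P)" "\<phi> ` verts P \<subseteq> verts D"
    and arc: "\<And>e. e \<in> arcs P \<Longrightarrow> \<phi> (tail P e) \<rightarrow>\<^bsub>D\<^esub> \<phi> (head P e)"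
  shows "contains D P"
proof -
  interpret P: digraph P by fact
  have "\<exists>a. a \<in> arcs D \<and> tail D a = \<phi> (tail P e) \<and> head D a = \<phi> (head P e)" if "e \<in> arcs P" for e
    using arc[OF that] by blast
  then obtain \<psi> where \<psi>: "\<And>e. e \<in> arcs P \<Longrightarrow> \<psi> e \<in> arcs D \<and> tail D (\<psi> e) = \<phi> (tail P e) \<and> head D (\<psi> e) = \<phi> (head P e)"
    by metis
  let ?f = "\<lparr>iso_verts = \<phi>, iso_arcs = \<psi>, iso_head = head D, iso_tail = tail D\<rparr>"
  have "inj_on \<psi> (arcs P)"
  proof (rule inj_onI)
    fix e f assume "e \<in> arcs P" "f \<in> arcs P" "\<psi> e = \<psi> f"
    then have "\<phi> (tail P e) = \<phi> (tail P f)" "\<phi> (head P e) = \<phi> (head P f)" using \<psi> by metis+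
    then have "tail P e = tail P f" "head P e = head P f"
      using \<open>e \<in> arcs P\<close> \<open>f \<in> arcs P\<close> inj_onD[OF assms(3)] by simp_all
    then show "e = f" using \<open>e \<in> arcs P\<close> \<open>f \<in> arcs P\<close> P.no_multi_arcs by (auto simp: arc_to_ends_def)
  qed
  then have "pre_digraph.digraph_isomorphism P ?f"
    using assms(3) \<psi> P.wf_digraph by (auto simp: pre_digraph.digraph_isomorphism_def)
  then have "digraph_iso P (app_iso ?f P)" unfolding digraph_iso_def by blast
  moreover have "wf_digraph (app_iso ?f P)"
    by unfold_locales (use \<psi> in auto)
  then have "subgraph (app_iso ?f P) D"
    using assms(2,4) \<psi> by (auto simp: subgraph_def compatible_def)
  ultimately show ?thesis unfolding contains_def by blast
qed

lemma confluent_nth: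
  assumes "confluent R s t"
  obtains vs where "length vs = s + t + 1" "distinct vs"
    "\<forall>i<s. R (vs ! i) (vs ! Suc i)"
    "\<forall>i. s \<le> i \<and> i < s + t \<longrightarrow> R (vs ! Suc i) (vs ! i)"
proof -
  obtain xs ys w where "successively R (xs @ [w])" "successively R (ys @ [w])"
    "distinct (xs @ ys @ [w])" "s \<le> length xs" "t \<le> length ys"
    using assms unfolding confluent_def by blast
  define as where "as = drop (length xs - s) xs"
  define bs where "bs = drop (length ys - t) ys"
  have len: "length as = s" "length bs = t"
    using \<open>s \<le> length xs\<close> \<open>t \<le> length ys\<close> by (auto simp: as_def bs_def)
  have "successively R (take n zs @ drop n zs @ [w]) \<Longrightarrow> successively R (drop n zs @ [w])" for n zs
    by (subst (asm) successively_append_iff) simp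
  then have drop: "successively R (zs @ [w]) \<Longrightarrow> successively R (drop n zs @ [w])" for n zs
    by (metis append.assoc append_take_drop_id)
  have succ: "successively R (as @ [w])" "successively R (bs @ [w])"
    unfolding as_def bs_def by (rule drop, fact)+
  have dist: "distinct (as @ w # rev bs)"
    using \<open>distinct (xs @ ys @ [w])\<close> by (auto simp: as_def bs_def dest: in_set_dropD)
  show ?thesis
  proof (rule that[of "as @ w # rev bs"])
    have "R ((as @ w # rev bs) ! i) ((as @ w # rev bs) ! Suc i)" if "i < s" for i
      using successively_nth[OF succ(1), of i] that len by (auto simp: nth_append less_Suc_eq split: if_splits)
    then show "\<forall>i<s. R ((as @ w # rev bs) ! i) ((as @ w # rev bs) ! Suc i)" by blast
    have "successively (\<lambda>x y. R y x) (w # rev bs)"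
      using succ(2) successively_rev[of "\<lambda>x y. R y x" "bs @ [w]"] by simp
    then have "R ((as @ w # rev bs) ! Suc i) ((as @ w # rev bs) ! i)" if "s \<le> i" "i < s + t" for i
      using successively_nth[of "\<lambda>x y. R y x" "w # rev bs" "i - s"] that len
      by (simp add: nth_append Suc_diff_le)
    then show "\<forall>i. s \<le> i \<and> i < s + t \<longrightarrow> R ((as @ w # rev bs) ! Suc i) ((as @ w # rev bs) ! i)"
      by blast
  qed (use len dist in auto)
qed

lemma oriented_graph_semidegree:
  assumes "oriented_graph D"
  shows "semidegree_digraph (verts D) (\<lambda>u v. u \<rightarrow>\<^bsub>D\<^esub> v) (min_semidegree D)"
    "semidegree_digraph (verts D) (\<lambda>u v. v \<rightarrow>\<^bsub>D\<^esub> u) (min_semidegree D)"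
proof -
  interpret D: oriented_graph D by fact
  have "bij_betw (head D) (out_arcs D v) {u. v \<rightarrow>\<^bsub>D\<^esub> u}" for v
    using D.no_multi_arcs by (auto simp: bij_betw_def inj_on_def arcs_ends_conv arc_to_ends_def image_iff)
  then have "out_degree D v = card {u. v \<rightarrow>\<^bsub>D\<^esub> u}" for v
    unfolding out_degree_def by (rule bij_betw_same_card)
  moreover have "bij_betw (tail D) (in_arcs D v) {u. u \<rightarrow>\<^bsub>D\<^esub> v}" for v
    using D.no_multi_arcs by (auto simp: bij_betw_def inj_on_def arcs_ends_conv arc_to_ends_def image_iff)
  then have "in_degree D v = card {u. u \<rightarrow>\<^bsub>D\<^esub> v}" for v
    unfolding in_degree_def by (rule bij_betw_same_card)
  moreover have "min_semidegree D \<le> out_degree D v" if "v \<in> verts D" for v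
    unfolding min_semidegree_def min_out_degree_def using that by (intro min.coboundedI1) simp
  moreover have "min_semidegree D \<le> in_degree D v" if "v \<in> verts D" for v
    unfolding min_semidegree_def min_in_degree_def using that by (intro min.coboundedI2) simp
  ultimately show "semidegree_digraph (verts D) (\<lambda>u v. u \<rightarrow>\<^bsub>D\<^esub> v) (min_semidegree D)"
    "semidegree_digraph (verts D) (\<lambda>u v. v \<rightarrow>\<^bsub>D\<^esub> u) (min_semidegree D)"
    using D.verts_nonempty D.no_two_cycle D.adj_in_verts
    by (unfold_locales; auto)+
qed

theorem theorem5:
  fixes k :: int
    and D :: "('a, 'b) pre_digraph"
    and P :: "('c, 'd) pre_digraph"
  assumes "oriented_graph D"
    and "real (min_semidegree D) > real_of_int k / 2"
    and "oriented_path P"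
    and "int (path_length P) = k"
    and "card (blocks P) = 2"
  shows "contains D P"
proof -
  interpret D: oriented_graph D by fact
  obtain us where us: "enumerated_path P us"
    using assms(3) unfolding oriented_path_def enumerated_path_def enumerated_path_axioms_def by blast
  interpret P: enumerated_path P us by (rule us)
  obtain m where m: "Suc (Suc m) < length us"
    and turn: "\<And>i. Suc i < length us \<Longrightarrow> P.forward i \<longleftrightarrow> (P.forward 0 \<longleftrightarrow> i \<le> m)"
    using P.two_blocks_one_turn assms(5) by blast
  define s where "s = Suc m"
  define t where "t = length us - 1 - s"
  \<comment> \<open>If \<open>P\<close> starts with a backward arc, its two branches leave the turning vertex, and the confluent
    paths are sought in the reverse of \<open>D\<close>.\<close>
  define R where "R u v \<longleftrightarrow> (if P.forward 0 then u \<rightarrow>\<^bsub>D\<^esub> v else v \<rightarrow>\<^bsub>D\<^esub> u)" for u v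
  have "length us = Suc (nat k)" using P.length_us assms(4) by (simp add: path_length_def)
  moreover have "k < 2 * int (min_semidegree D)" using assms(2) by linarith
  ultimately have st: "1 \<le> s" "1 \<le> t" "length us = s + t + 1" "s + t < 2 * min_semidegree D"
    using m by (auto simp: s_def t_def)
  have "semidegree_digraph (verts D) R (min_semidegree D)"
    using oriented_graph_semidegree[OF assms(1)] unfolding R_def by (cases "P.forward 0") simp_all
  then have "confluent R s t" using st by (intro semidegree_digraph.confluent_paths)
  then obtain vs where vs: "length vs = s + t + 1" "distinct vs"
    "\<forall>i<s. R (vs ! i) (vs ! Suc i)" "\<forall>i. s \<le> i \<and> i < s + t \<longrightarrow> R (vs ! Suc i) (vs ! i)"
    by (rule confluent_nth)
  define \<phi> where "\<phi> v = vs ! (THE i. i < length us \<and> us ! i = v)" for v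
  have \<phi>: "\<phi> (us ! i) = vs ! i" if "i < length us" for i
    unfolding \<phi>_def using that by (intro arg_cong[of _ _ "(!) vs"] the_equality) (auto simp: P.us_eq)
  show ?thesis
  proof (rule contains_if_embedding[of P D \<phi>])
    show "inj_on \<phi> (verts P)"
    proof (rule inj_onI)
      fix u v assume "u \<in> verts P" "v \<in> verts P" "\<phi> u = \<phi> v"
      then show "u = v"
        using \<phi> vs(1,2) st(3) by (auto simp: in_set_conv_nth nth_eq_iff_index_eq simp flip: P.set_us)
    qed
    show image_arc: "\<phi> (tail P e) \<rightarrow>\<^bsub>D\<^esub> \<phi> (head P e)" if "e \<in> arcs P" for e
    proof -
      obtain i where i: "P.at_edge e i" using P.arc_at_edge[OF \<open>e \<in> arcs P\<close>] by blast
      then have len: "Suc i < length us" by (simp add: P.at_edge_def)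
      then show ?thesis
        using P.at_edge_orientation[OF i] \<phi>[of i] \<phi>[of "Suc i"] turn[OF len] vs(3)[rule_format, of i] vs(4)[rule_format, of i] st(3)
        unfolding R_def s_def by (cases "i \<le> m"; cases "P.forward 0") auto
    qed
    show "\<phi> ` verts P \<subseteq> verts D"
    proof (clarify)
      fix v assume "v \<in> verts P"
      then obtain i where i: "i < length us" "v = us ! i" by (auto simp: in_set_conv_nth simp flip: P.set_us)
      have "R u v \<Longrightarrow> u \<in> verts D \<and> v \<in> verts D" for u v
        using D.adj_in_verts unfolding R_def by (auto split: if_splits)
      moreover consider "i < s" | "i = s" | j where "i = Suc j" "s \<le> j" "j < s + t"
        using i(1) st(3) by (cases i) fastforce+
      then have "\<exists>u. R u (vs ! i) \<or> R (vs ! i) u"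
      proof cases
        case 2
        then show ?thesis using vs(3) st(1) by (metis One_nat_def Suc_le_D lessI)
      qed (use vs(3,4) in blast)+
      ultimately show "\<phi> v \<in> verts D" using i \<phi>[of i] by auto
    qed
  qed (use P.digraph_axioms D.wf_digraph in auto)
qed

end
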